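(* Let $L$ be a planar semimodular lattice (with an associated planar diagram), and let $\mathfrak{p}, \mathfrak{q}$ be distinct prime intervals in $L$. Then $\mathfrak{p}$ congruence spreads to $\mathfrak{q}$ if and only if there exists a $\mathrm{PS}^{\mathrm c}$ sequence from $\mathfrak{p}$ to $\mathfrak{q}$.
   Context: A planar lattice is by definition finite: a finite lattice having a planar Hasse diagram. Semimodular means upper semimodular. A prime interval $\mathfrak{p}=[0_{\mathfrak p},1_{\mathfrak p}]$ is an interval with $0_{\mathfrak p}$ covered by $1_{\mathfrak p}$. $\mathrm{con}(\mathfrak{p})$ is the least congruence of $L$ collapsing $0_{\mathfrak p}$ and $1_{\mathfrak p}$; $\mathfrak p$ congruence spreads to $\mathfrak q$ if $\mathrm{con}(\mathfrak p)\ge\mathrm{con}(\mathfrak q)$. A 4-cell $S=\{0_S,v,w,1_S\}$ in $L$ (with its associated planar diagram) is a covering square ($v\ne w$, $0_S\prec v\prec 1_S$, $0_S\prec w\prec 1_S$ in $L$) with no internal element, i.e. no element of $L$ lies in the interior of the region of the diagram bounded by the square. Its pairs of opposite sides are $[0_S,v],[w,1_S]$ and $[0_S,w],[v,1_S]$. $\mathsf{S}_7$ is the 7-element lattice with elements $u,y,o,x,a,m,i$ whose covering relations are $u\prec y$, $u\prec o$, $y\prec x$, $y\prec a$, $o\prec a$, $o\prec m$, $x\prec i$, $a\prec i$, $m\prec i$. Of its three dual atoms $x,a,m$, exactly one, $a=y\vee o$, is a proper join (i.e. join-reducible). Swing: $\mathfrak p$ swings to $\mathfrak q$ if (i) $\mathfrak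 p\ne\mathfrak q$; (ii) $1_{\mathfrak p}=1_{\mathfrak q}$; (iii) there is a lower cover $c\neq 0_{\mathfrak p},0_{\mathfrak q}$ of $1_{\mathfrak p}$ such that $\{0_{\mathfrak p},0_{\mathfrak q},c\}$ generates a sublattice $S$ of $L$ isomorphic to $\mathsf{S}_7$, where $0_{\mathfrak q}$ is the unique dual atom of $S$ that is a proper join (in $S$). Switch: for distinct prime intervals $\mathfrak p,\mathfrak q$ in $L$, $\mathfrak p$ switches to $\mathfrak q$ if both lie in a common covering $\mathsf{M}_3$ in $L$, i.e. in a common sublattice of $L$ that is isomorphic to $\mathsf{M}_3$ (the 5-element modular lattice of length 2 with three atoms) and whose covering relations are covering relations of $L$. A $\mathrm{PS}^{\mathrm c}$ sequence from $\mathfrak p$ to $\mathfrak q$ is a sequence $\mathfrak r_0=\mathfrak p,\mathfrak r_1,\dots,\mathfrak r_{n-1},\mathfrak r_n=\mathfrak q$ of prime intervals of $L$ such that, for each $1\le i\le n$, one of the following holds: (i) $\mathfrak r_{i-1}$ and $\mathfrak r_i$ are cell perspective, that is, they are opposite sides of the same 4-cell; (ii) $\mathfrak r_{i-1}$ swings to $\mathfrak r_i$; (iii) $\mathfrak r_{i-1}$ switches to $\mathfrak r_i$. *)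

theory Defs
  imports "HOL-Analysis.Analysis"
begin

section \<open>Covering relations and semimodularity\<close>

definition covered_in :: "'a::order set \<Rightarrow> 'a \<Rightarrow> 'a \<Rightarrow> bool" where
  "covered_in S a b \<longleftrightarrow> a \<in> S \<and> b \<in> S \<and> a < b \<and> \<not> (\<exists>z\<in>S. a < z \<and> z < b)"

abbreviation covered_by :: "'a::order \<Rightarrow> 'a \<Rightarrow> bool"  (infix \<open>\<lessdot>\<close> 50) where
  "a \<lessdot> b \<equiv> covered_in UNIV a b"

definition upper_semimodular :: "'a::lattice itself \<Rightarrow> bool" where
  "upper_semimodular _ \<longleftrightarrow>
     (\<forall>a b c :: 'a. a \<lessdot> b \<longrightarrow> sup a c \<lessdot> sup b c \<or> sup a c = sup b c)"


section \<open>Planar diagrams\<close>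

text \<open>
  A Hasse diagram places the elements at distinct points of the plane, here the complex plane
  with \<^const>\<open>Im\<close> as height, so that every covering pair is drawn as a straight segment that
  goes upwards. It is planar if two distinct edges meet at most in a common endpoint.
  In a lattice with more than one element every element is an endpoint of some edge, so this
  also excludes that an element lies in the middle of an edge.
\<close>

definition planar_diagram :: "('a::order \<Rightarrow> complex) \<Rightarrow> bool" where
  "planar_diagram D \<longleftrightarrow>
     inj D \<and>
     (\<forall>a b. a \<lessdot> b \<longrightarrow> Im (D a) < Im (D b)) \<and>
     (\<forall>a b c d. a \<lessdot> b \<and> c \<lessdot> d \<and> (a, b) \<noteq> (c, d) \<longrightarrow>
        closed_segment (D a) (D b) \<inter> closed_segment (D c) (D d) \<subseteq> D ` ({a, b} \<inter> {c, d}))"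

text \<open>
  The region bounded by a covering square need not be convex, hence \<^const>\<open>inside\<close> (the union
  of the bounded components of the complement) instead of a convex hull.
\<close>

definition four_cell :: "('a::order \<Rightarrow> complex) \<Rightarrow> 'a \<Rightarrow> 'a \<Rightarrow> 'a \<Rightarrow> 'a \<Rightarrow> bool" where
  "four_cell D o' v w i \<longleftrightarrow>
     v \<noteq> w \<and> o' \<lessdot> v \<and> v \<lessdot> i \<and> o' \<lessdot> w \<and> w \<lessdot> i \<and>
     \<not> (\<exists>z. D z \<in> inside (closed_segment (D o') (D v) \<union> closed_segment (D v) (D i) \<union>
                        closed_segment (D o') (D w) \<union> closed_segment (D w) (D i)))"


section \<open>Prime intervals and congruences\<close>

text \<open>An interval \<open>[a, b]\<close> is represented by the pair \<open>(a, b)\<close> of its endpoints.\<close>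

definition prime_interval :: "'a::order \<times> 'a \<Rightarrow> bool" where
  "prime_interval p \<longleftrightarrow> fst p \<lessdot> snd p"

definition lattice_congruence :: "'a::lattice rel \<Rightarrow> bool" where
  "lattice_congruence \<theta> \<longleftrightarrow>
     equiv UNIV \<theta> \<and>
     (\<forall>a b c d. (a, b) \<in> \<theta> \<and> (c, d) \<in> \<theta> \<longrightarrow>
        (sup a c, sup b d) \<in> \<theta> \<and> (inf a c, inf b d) \<in> \<theta>)"

definition con :: "'a::lattice \<times> 'a \<Rightarrow> 'a rel" where
  "con p = \<Inter> {\<theta>. lattice_congruence \<theta> \<and> p \<in> \<theta>}"

lemma lattice_congruence_con: "lattice_congruence (con p)"
proof -
  let ?C = "{\<theta>. lattice_congruence \<theta> \<and> p \<in> \<theta>}"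
  have eq: "equiv UNIV \<theta>" if "\<theta> \<in> ?C" for \<theta>
    using that by (simp add: lattice_congruence_def)
  have "equiv UNIV (con p)"
  proof (rule equivI)
    show "con p \<subseteq> UNIV \<times> UNIV" by simp
    show "refl_on UNIV (con p)"
      using eq unfolding con_def equiv_def refl_on_def by fast
    show "sym (con p)"
      using eq by (intro symI) (force simp: con_def elim: equivE dest: symD)
    show "trans (con p)"
    proof (rule transI)
      fix x y z assume "(x, y) \<in> con p" "(y, z) \<in> con p"
      then show "(x, z) \<in> con p"
        using eq unfolding con_def equiv_def by (auto dest: transD)
    qed
  qed
  then show ?thesis
    unfolding lattice_congruence_def by (simp add: con_def lattice_congruence_def)
qed

lemma con_collapses: "p \<in> con p"
  by (simp add: con_def)

lemma con_least: "lattice_congruence \<theta> \<Longrightarrow> p \<in> \<theta> \<Longrightarrow> con p \<subseteq> \<theta>"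
  by (auto simp: con_def)

definition congruence_spreads :: "'a::lattice \<times> 'a \<Rightarrow> 'a \<times> 'a \<Rightarrow> bool" where
  "congruence_spreads p q \<longleftrightarrow> con q \<subseteq> con p"


section \<open>Sublattices\<close>

definition sublattice :: "'a::lattice set \<Rightarrow> bool" where
  "sublattice S \<longleftrightarrow> S \<noteq> {} \<and> (\<forall>a\<in>S. \<forall>b\<in>S. sup a b \<in> S \<and> inf a b \<in> S)"

definition sublattice_generated :: "'a::lattice set \<Rightarrow> 'a set" where
  "sublattice_generated X = \<Inter> {S. sublattice S \<and> X \<subseteq> S}"

definition lattice_iso_onto :: "('b::lattice \<Rightarrow> 'a::lattice) \<Rightarrow> 'a set \<Rightarrow> bool" where
  "lattice_iso_onto f S \<longleftrightarrow>
     bij_betw f UNIV S \<and>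
     (\<forall>a b. f (sup a b) = sup (f a) (f b) \<and> f (inf a b) = inf (f a) (f b))"

definition dual_atom_in :: "'a::order set \<Rightarrow> 'a \<Rightarrow> bool" where
  "dual_atom_in S d \<longleftrightarrow> (\<exists>t\<in>S. (\<forall>s\<in>S. s \<le> t) \<and> covered_in S d t)"

definition proper_join_in :: "'a::lattice set \<Rightarrow> 'a \<Rightarrow> bool" where
  "proper_join_in S d \<longleftrightarrow> (\<exists>s\<in>S. \<exists>t\<in>S. d = sup s t \<and> d \<noteq> s \<and> d \<noteq> t)"


section \<open>The lattices S7 and M3\<close>

datatype s7 = S7_u | S7_y | S7_o | S7_x | S7_a | S7_m | S7_i

instantiation s7 :: lattice
begin

definition less_eq_s7 :: "s7 \<Rightarrow> s7 \<Rightarrow> bool" where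
  "less_eq_s7 p q \<longleftrightarrow> p = q \<or> p = S7_u \<or> q = S7_i \<or>
     (p, q) \<in> {(S7_y, S7_x), (S7_y, S7_a), (S7_o, S7_a), (S7_o, S7_m)}"

definition less_s7 :: "s7 \<Rightarrow> s7 \<Rightarrow> bool" where
  "less_s7 p q \<longleftrightarrow> p \<le> q \<and> p \<noteq> q"

definition sup_s7 :: "s7 \<Rightarrow> s7 \<Rightarrow> s7" where
  "sup_s7 p q =
     (if p \<le> q then q else if q \<le> p then p
      else if p \<le> S7_a \<and> q \<le> S7_a then S7_a else S7_i)"

definition inf_s7 :: "s7 \<Rightarrow> s7 \<Rightarrow> s7" where
  "inf_s7 p q =
     (if p \<le> q then p else if q \<le> p then q
      else if S7_y \<le> p \<and> S7_y \<le> q then S7_y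
      else if S7_o \<le> p \<and> S7_o \<le> q then S7_o else S7_u)"

instance
proof
  fix p q r :: s7
  show "(p < q) = (p \<le> q \<and> \<not> q \<le> p)"
    by (cases p; cases q) (simp_all add: less_s7_def less_eq_s7_def)
  show "p \<le> p"
    by (simp add: less_eq_s7_def)
  show "p \<le> q \<Longrightarrow> q \<le> r \<Longrightarrow> p \<le> r"
    by (cases p; cases q; cases r) (simp_all add: less_eq_s7_def)
  show "p \<le> q \<Longrightarrow> q \<le> p \<Longrightarrow> p = q"
    by (cases p; cases q) (simp_all add: less_eq_s7_def)
  show "inf p q \<le> p" "inf p q \<le> q" "p \<le> sup p q" "q \<le> sup p q"
    by (cases p; cases q; simp add: less_eq_s7_def inf_s7_def sup_s7_def)+
  show "p \<le> q \<Longrightarrow> p \<le> r \<Longrightarrow> p \<le> inf q r"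
    by (cases p; cases q; cases r) (simp_all add: less_eq_s7_def inf_s7_def)
  show "q \<le> p \<Longrightarrow> r \<le> p \<Longrightarrow> sup q r \<le> p"
    by (cases p; cases q; cases r) (simp_all add: less_eq_s7_def sup_s7_def)
qed

end

lemma s7_all: "(\<forall>z. P z) \<longleftrightarrow>
    P S7_u \<and> P S7_y \<and> P S7_o \<and> P S7_x \<and> P S7_a \<and> P S7_m \<and> P S7_i"
  using s7.induct[of P] by blast

lemma s7_covered_by_iff:
  "p \<lessdot> q \<longleftrightarrow> (p, q) \<in> {(S7_u, S7_y), (S7_u, S7_o), (S7_y, S7_x), (S7_y, S7_a), (S7_o, S7_a),
                     (S7_o, S7_m), (S7_x, S7_i), (S7_a, S7_i), (S7_m, S7_i)}"
proof -
  have "p \<lessdot> q \<longleftrightarrow> p < q \<and> (\<forall>z. \<not> (p < z \<and> z < q))"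
    by (simp add: covered_in_def)
  then show ?thesis
    unfolding s7_all by (cases p; cases q) (simp_all add: less_s7_def less_eq_s7_def)
qed

datatype m3 = M3_zero | M3_a | M3_b | M3_c | M3_one

instantiation m3 :: lattice
begin

definition less_eq_m3 :: "m3 \<Rightarrow> m3 \<Rightarrow> bool" where
  "less_eq_m3 p q \<longleftrightarrow> p = q \<or> p = M3_zero \<or> q = M3_one"

definition less_m3 :: "m3 \<Rightarrow> m3 \<Rightarrow> bool" where
  "less_m3 p q \<longleftrightarrow> p \<le> q \<and> p \<noteq> q"

definition sup_m3 :: "m3 \<Rightarrow> m3 \<Rightarrow> m3" where
  "sup_m3 p q = (if p \<le> q then q else if q \<le> p then p else M3_one)"

definition inf_m3 :: "m3 \<Rightarrow> m3 \<Rightarrow> m3" where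
  "inf_m3 p q = (if p \<le> q then p else if q \<le> p then q else M3_zero)"

instance
  by standard (auto simp: less_m3_def less_eq_m3_def sup_m3_def inf_m3_def)

end


section \<open>Perspectivities, swings, switches\<close>

definition cell_perspective ::
    "('a::order \<Rightarrow> complex) \<Rightarrow> 'a \<times> 'a \<Rightarrow> 'a \<times> 'a \<Rightarrow> bool" where
  "cell_perspective D p q \<longleftrightarrow>
     (\<exists>o' v w i. four_cell D o' v w i \<and>
        ({p, q} = {(o', v), (w, i)} \<or> {p, q} = {(o', w), (v, i)}))"

definition swings :: "'a::lattice \<times> 'a \<Rightarrow> 'a \<times> 'a \<Rightarrow> bool" where
  "swings p q \<longleftrightarrow>
     p \<noteq> q \<and> snd p = snd q \<and>
     (\<exists>c S. c \<lessdot> snd p \<and> c \<noteq> fst p \<and> c \<noteq> fst q \<and>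
        S = sublattice_generated {fst p, fst q, c} \<and>
        (\<exists>f :: s7 \<Rightarrow> 'a. lattice_iso_onto f S) \<and>
        {d. dual_atom_in S d \<and> proper_join_in S d} = {fst q})"

definition covering_m3 :: "'a::lattice set \<Rightarrow> bool" where
  "covering_m3 S \<longleftrightarrow>
     sublattice S \<and>
     (\<exists>f :: m3 \<Rightarrow> 'a. lattice_iso_onto f S) \<and>
     (\<forall>a b. covered_in S a b \<longrightarrow> a \<lessdot> b)"

definition switches :: "'a::lattice \<times> 'a \<Rightarrow> 'a \<times> 'a \<Rightarrow> bool" where
  "switches p q \<longleftrightarrow>
     p \<noteq> q \<and> (\<exists>S. covering_m3 S \<and> {fst p, snd p, fst q, snd q} \<subseteq> S)"

definition ps_c_sequence ::
    "('a::lattice \<Rightarrow> complex) \<Rightarrow> 'a \<times> 'a \<Rightarrow> 'a \<times> 'a \<Rightarrow> nat \<Rightarrow> (nat \<Rightarrow> 'a \<times> 'a) \<Rightarrow> bool" where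
  "ps_c_sequence D p q n r \<longleftrightarrow>
     r 0 = p \<and> r n = q \<and>
     (\<forall>i\<le>n. prime_interval (r i)) \<and>
     (\<forall>i\<in>{1..n}. cell_perspective D (r (i - 1)) (r i) \<or>
                 swings (r (i - 1)) (r i) \<or>
                 switches (r (i - 1)) (r i))"

end

theory Submission
  imports Defs
begin

text \<open>
  A congruence that collapses a prime interval collapses every interval reached from it by a step,
  which gives one direction. For the other, let \<open>R\<close> be the set of prime intervals reachable
  from \<open>p\<close>; it suffices that the pairs \<open>(a, b)\<close> for which \<open>R\<close>-edges lead
  from \<open>inf a b\<close> to \<open>sup a b\<close> form a congruence.

  A covering square that is not a 4-cell has a third element between its bottom and its top, hence
  lies in a covering \<open>M\<^sub>3\<close>. So \<open>R\<close> is closed under opposite sides of covering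
  squares, and semimodularity makes \<open>R\<close>-chains stable under joins.

  For meets, order the lower covers of \<open>x\<close> by the slopes of their edges to
  \<open>x\<close>. Planarity gives \<open>inf a b \<le> c\<close> whenever \<open>c\<close> lies between
  \<open>a\<close> and \<open>b\<close>, and semimodularity gives, for lower covers \<open>y\<close>, \<open>z\<close>
  that do not span a covering square, a lower cover \<open>c\<close> between them that spans one with
  \<open>z\<close>. Three lower covers \<open>a\<close>, \<open>c\<close>, \<open>b\<close> in this order such that
  \<open>c\<close> spans covering squares with \<open>a\<close> and \<open>b\<close> yield a switch or a swing
  from \<open>(a, x)\<close> to \<open>(c, x)\<close>. So if \<open>(y, x) \<in> R\<close>, then
  \<open>(c, x) \<in> R\<close> for all lower covers \<open>c\<close> of \<open>x\<close> strictly between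
  \<open>y\<close> and another one \<open>z\<close>, and an induction on \<open>x\<close> and on the number
  of lower covers between \<open>y\<close> and \<open>z\<close> yields an \<open>R\<close>-chain from
  \<open>inf y z\<close> to \<open>z\<close>.
\<close>

section \<open>Covers in finite semimodular lattices\<close>

lemma coveredD: "a \<lessdot> b \<Longrightarrow> a < b"
  by (simp add: covered_in_def)

lemma covered_between: "a \<lessdot> b \<Longrightarrow> a \<le> c \<Longrightarrow> c \<le> b \<Longrightarrow> c = a \<or> c = b"
  unfolding covered_in_def by (metis UNIV_I order_le_less)

lemma covered_above:
  fixes a b :: "'a::{finite,order}"
  assumes "a < b"
  obtains c where "a \<lessdot> c" "c \<le> b"
proof -
  have "finite {c. a < c \<and> c \<le> b}" "{c. a < c \<and> c \<le> b} \<noteq> {}"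
    using assms by auto
  from finite_has_minimal[OF this] obtain c where
    c: "a < c" "c \<le> b" "\<And>d. a < d \<Longrightarrow> d \<le> b \<Longrightarrow> d \<le> c \<Longrightarrow> c = d"
    by blast
  have "a \<lessdot> c"
    unfolding covered_in_def using c by (auto dest: less_imp_le) (metis less_imp_le order.strict_trans2 order_less_irrefl)
  with c that show thesis by blast
qed

lemma covered_below:
  fixes a b :: "'a::{finite,order}"
  assumes "a < b"
  obtains c where "a \<le> c" "c \<lessdot> b"
proof -
  have "finite {c. a \<le> c \<and> c < b}" "{c. a \<le> c \<and> c < b} \<noteq> {}"
    using assms by auto
  from finite_has_maximal[OF this] obtain c where
    c: "a \<le> c" "c < b" "\<And>d. a \<le> d \<Longrightarrow> d < b \<Longrightarrow> c \<le> d \<Longrightarrow> c = d"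
    by blast
  have "c \<lessdot> b"
    unfolding covered_in_def using c by (auto dest: less_imp_le) (metis less_imp_le order.strict_trans1 order_less_irrefl)
  with c that show thesis by blast
qed

lemma finite_order_induct [case_names less]:
  fixes x :: "'a::{finite,order}"
  assumes "\<And>x. (\<And>y. y < x \<Longrightarrow> P y) \<Longrightarrow> P x"
  shows "P x"
proof (induction "card {y. y < x}" arbitrary: x rule: less_induct)
  case less
  have "card {z. z < y} < card {y. y < x}" if "y < x" for y
    using that by (intro psubset_card_mono) auto
  with less show ?case using assms by blast
qed

lemma covered_chain:
  fixes a b :: "'a::{finite,order}"
  assumes "a \<le> b"
  shows "(a, b) \<in> {(x, y). x \<lessdot> y}\<^sup>*"
  using assms
proof (induction b rule: finite_order_induct)
  case (less b)
  show ?case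
  proof (cases "a = b")
    case False
    then obtain c where "a \<le> c" "c \<lessdot> b" using less.prems by (metis covered_below order_le_less)
    then show ?thesis using less.IH[of c] coveredD by (auto intro: rtrancl_into_rtrancl)
  qed simp
qed

lemma coatoms_sup:
  fixes v w i :: "'a::lattice"
  assumes "v \<lessdot> i" "w \<lessdot> i" "v \<noteq> w"
  shows "sup v w = i"
  by (metis assms covered_between coveredD less_le_not_le sup.cobounded1 sup.cobounded2 sup.order_iff sup_least order_less_imp_le)

lemma atoms_inf:
  fixes v w u :: "'a::lattice"
  assumes "u \<lessdot> v" "u \<lessdot> w" "v \<noteq> w"
  shows "inf v w = u"
  by (metis assms covered_between coveredD less_le_not_le inf.cobounded1 inf.cobounded2 inf.order_iff inf_greatest order_less_imp_le)

lemma coatom_le_iff: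
  fixes v w i :: "'a::order"
  assumes "v \<lessdot> i" "w \<lessdot> i"
  shows "v \<le> w \<longleftrightarrow> v = w"
  by (metis assms covered_between coveredD less_le_not_le order_less_imp_le order_refl)

section \<open>Consequences of upper semimodularity\<close>

locale semimodular =
  fixes type :: "'a::{finite,lattice} itself"
  assumes sm: "upper_semimodular TYPE('a)"
begin

lemma sup_covered: "a \<lessdot> b \<Longrightarrow> sup a c \<lessdot> sup b c \<or> sup a c = sup b c" for a b c :: 'a
  using sm unfolding upper_semimodular_def by blast

lemma atoms_sup_covered:
  fixes u v w :: 'a
  assumes "u \<lessdot> v" "u \<lessdot> w" "v \<noteq> w"
  shows "v \<lessdot> sup v w" "w \<lessdot> sup v w"
proof -
  have *: "w \<lessdot> sup v w" if "u \<lessdot> v" "u \<lessdot> w" "v \<noteq> w" for v w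
    using sup_covered[OF that(1), of w] that
    by (metis coveredD covered_between less_le_not_le order_less_imp_le sup.absorb2 sup.cobounded1)
  show "w \<lessdot> sup v w" using * assms by blast
  show "v \<lessdot> sup v w" using *[of w v] assms by (simp add: sup.commute)
qed

text \<open>For a cover \<open>a\<close> of \<open>inf v w\<close> below \<open>v\<close>,
  semimodularity makes \<open>a\<close> a lower cover of \<open>sup a w\<close>, which must be
  \<open>i\<close>. So \<open>a\<close> is a lower cover of \<open>i\<close> below \<open>v\<close>,
  that is, \<open>a = v\<close>.\<close>

lemma coatoms_inf_covered_commute:
  fixes v w i :: 'a
  assumes "v \<lessdot> i" "w \<lessdot> i" "v \<noteq> w" "inf v w \<lessdot> w"
  shows "inf v w \<lessdot> v"
proof -
  have "inf v w < v"
    using assms coatom_le_iff by (metis inf.cobounded1 inf.absorb_iff1 order_le_less)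
  then obtain a where a: "inf v w \<lessdot> a" "a \<le> v" by (rule covered_above)
  have "a \<noteq> w" using assms coatom_le_iff a by metis
  then have aw: "a \<lessdot> sup a w" "w \<lessdot> sup a w" using atoms_sup_covered a assms by blast+
  have "sup a w \<le> i" using a assms coveredD by (meson dual_order.trans le_supI less_imp_le)
  then have "sup a w = i" using aw assms covered_between coveredD
    by (metis less_imp_le less_irrefl)
  then have "a \<lessdot> i" using aw by simp
  then have "a = v" using a assms coatom_le_iff by blast
  with a show ?thesis by simp
qed

text \<open>The last two conclusions serve to rule out, in a planar diagram, that \<open>y\<close>
  or \<open>z\<close> is the middle one of the three lower covers; this puts \<open>c\<close>
  between them.\<close>

lemma third_coatom:
  fixes x y z :: 'a
  assumes "y \<lessdot> x" "z \<lessdot> x" "y \<noteq> z" "\<not> inf y z \<lessdot> z"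
  obtains c where "c \<lessdot> x" "c \<noteq> y" "c \<noteq> z" "inf c z \<lessdot> z" "\<not> inf c y \<le> z" "\<not> inf c z \<le> y"
proof -
  let ?u = "inf y z"
  have "?u < y" "?u < z"
    using assms coatom_le_iff by (metis inf.cobounded1 inf.cobounded2 inf.absorb_iff1 inf.absorb_iff2 order_le_less)+
  obtain a where a: "?u \<lessdot> a" "a \<le> y" using \<open>?u < y\<close> by (rule covered_above)
  obtain b where b: "?u \<le> b" "b \<lessdot> z" using \<open>?u < z\<close> by (rule covered_below)
  have bu: "b \<noteq> ?u" using b assms by blast
  have az: "\<not> a \<le> z" using a coveredD by (metis inf_greatest leD)
  have "\<not> b \<le> y" using b bu coveredD by (metis inf_greatest less_imp_le order_antisym)
  \<comment> \<open>As \<open>b\<close> is covered by \<open>z\<close> and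
    \<open>sup z a = x\<close>, this join is \<open>x\<close> or a lower cover of \<open>x\<close>.
    If it were \<open>x\<close>, then, \<open>?u\<close> being covered by \<open>a\<close>, either
    \<open>b = x\<close> or \<open>b\<close> would be a lower cover of \<open>x\<close>, although
    \<open>z\<close> lies strictly between them.\<close>
  let ?c = "sup b a"
  have "a \<le> x" using a assms(1) coveredD by (meson dual_order.trans less_imp_le)
  have "z \<le> x" using assms(2) coveredD less_imp_le by blast
  have "sup z a = x"
  proof -
    have "sup z a \<le> x" using \<open>a \<le> x\<close> \<open>z \<le> x\<close> by simp
    then show ?thesis
      using covered_between[OF assms(2), of "sup z a"] az by (metis sup.cobounded1 sup.cobounded2)
  qed
  have "b < x" "b < z" "z < x" using b assms(2) coveredD order.strict_trans by blast+
  have "?c \<noteq> x"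
  proof
    assume *: "?c = x"
    have "b \<lessdot> x \<or> b = x"
      using sup_covered[OF a(1), of b] * sup.absorb2[OF b(1)] sup.commute[of a b] by simp
    then show False
      using \<open>b < x\<close> \<open>b < z\<close> \<open>z < x\<close> by (auto simp: covered_in_def)
  qed
  then have c: "?c \<lessdot> x" using sup_covered[OF b(2), of a] \<open>sup z a = x\<close> by simp
  have cy: "?c \<noteq> y" using \<open>\<not> b \<le> y\<close> by auto
  have cz: "?c \<noteq> z" using az by auto
  have "inf ?c z = b"
  proof -
    have "b \<le> inf ?c z" using \<open>b < z\<close> by simp
    moreover have "inf ?c z \<noteq> z" using coatom_le_iff[OF assms(2) c] cz by (metis inf.absorb_iff2)
    ultimately show ?thesis using covered_between[OF b(2)] by (metis inf.cobounded2)
  qed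
  moreover have "a \<le> inf ?c y" using a by simp
  ultimately show thesis
    using that[OF c cy cz] b az \<open>\<not> b \<le> y\<close> by (metis order.trans)
qed

end

section \<open>Left-to-right order of lower covers in a planar diagram\<close>

lemma Im_diagram_strict:
  fixes D :: "'a::{finite,order} \<Rightarrow> complex"
  assumes "planar_diagram D" "a < b"
  shows "Im (D a) < Im (D b)"
proof -
  have "a < b \<longrightarrow> Im (D a) < Im (D b)"
  proof (induction b rule: finite_order_induct)
    case (less b)
    show ?case
    proof
      assume "a < b"
      then obtain c where c: "a \<le> c" "c \<lessdot> b" by (rule covered_below)
      then have "Im (D c) < Im (D b)" using assms(1) by (auto simp: planar_diagram_def)
      moreover have "Im (D a) \<le> Im (D c)"
        using less[of c] c coveredD by (metis less_eq_real_def order_le_less)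
      ultimately show "Im (D a) < Im (D b)" by simp
    qed
  qed
  with assms show ?thesis by blast
qed

lemma Im_diagram_mono:
  fixes D :: "'a::{finite,order} \<Rightarrow> complex"
  assumes "planar_diagram D" "a \<le> b"
  shows "Im (D a) \<le> Im (D b)"
  using Im_diagram_strict[OF assms(1), of a b] assms(2) by (auto simp: order_le_less)

lemma diagram_edges_meet:
  assumes "planar_diagram D" "a \<lessdot> b" "c \<lessdot> d"
    and "P \<in> closed_segment (D a) (D b)" "P \<in> closed_segment (D c) (D d)"
  obtains "a = c" "b = d" | e where "P = D e" "e \<in> {a, b}" "e \<in> {c, d}"
  using assms unfolding planar_diagram_def by (cases "(a, b) = (c, d)") blast+

text \<open>Horizontal displacement per unit of descent from \<open>D x\<close>: a vertical edge
  gets 0, and increasing values order the edges below \<open>x\<close> from left to right.\<close>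

definition slope :: "('a \<Rightarrow> complex) \<Rightarrow> 'a \<Rightarrow> 'a \<Rightarrow> real" where
  "slope D x c = (Re (D c) - Re (D x)) / (Im (D x) - Im (D c))"

lemma on_edge:
  assumes "Im (D c) < Im (D x)" "h \<in> {Im (D c)..Im (D x)}"
  shows "Complex (Re (D x) + slope D x c * (Im (D x) - h)) h \<in> closed_segment (D c) (D x)"
proof -
  define t where "t = (h - Im (D c)) / (Im (D x) - Im (D c))"
  have t: "0 \<le> t" "t \<le> 1" using assms by (auto simp: t_def divide_simps)
  have h: "h - Im (D c) = t * (Im (D x) - Im (D c))" using assms by (simp add: t_def)
  have s: "Re (D c) - Re (D x) = slope D x c * (Im (D x) - Im (D c))"
    using assms by (simp add: slope_def)
  have "Im (D x) - h = (1 - t) * (Im (D x) - Im (D c))" using h by (simp add: algebra_simps)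
  then have "slope D x c * (Im (D x) - h) = (1 - t) * (Re (D c) - Re (D x))"
    unfolding s by simp
  then have "Complex (Re (D x) + slope D x c * (Im (D x) - h)) h = (1 - t) *\<^sub>R D c + t *\<^sub>R D x"
    using h by (simp add: complex_eq_iff algebra_simps)
  with t show ?thesis unfolding closed_segment_def by blast
qed

text \<open>Two edges that leave \<open>D x\<close> downwards in the same direction overlap, so the
  higher of their lower ends lies on the other edge; by planarity it is an end of that edge
  too.\<close>

lemma slope_inj:
  assumes pd: "planar_diagram D" and "c \<lessdot> x" "d \<lessdot> x" "slope D x c = slope D x d"
  shows "c = d"
proof -
  have *: "c = d"
    if h: "c \<lessdot> x" "d \<lessdot> x" "slope D x c = slope D x d" "Im (D d) \<le> Im (D c)" for c d
  proof -
    have im: "Im (D c) < Im (D x)" "Im (D d) < Im (D x)"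
      using pd h by (auto simp: planar_diagram_def)
    have "Complex (Re (D x) + slope D x d * (Im (D x) - Im (D c))) (Im (D c)) = D c"
      using im unfolding h(3)[symmetric] by (simp add: complex_eq_iff slope_def)
    then have "D c \<in> closed_segment (D d) (D x)"
      using on_edge[of D d x "Im (D c)"] im h(4) by simp
    then show ?thesis
    proof (rule diagram_edges_meet[OF pd h(1,2), of "D c", rotated])
      fix e assume "D c = D e" "e \<in> {c, x}" "e \<in> {d, x}"
      then show "c = d" using pd im unfolding planar_diagram_def by (auto dest: injD)
    qed auto
  qed
  show ?thesis
    using *[OF assms(2-4)] *[OF assms(3,2) assms(4)[symmetric]] by (metis linear)
qed

text \<open>A chain of edges from \<open>x\<close> through \<open>c\<close> down to \<open>w\<close>
  is the graph of a continuous function of the height, since every edge is strictly monotone in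
  height. The third property allows paths to be compared near \<open>x\<close> by slopes; the fourth
  records where in the order the edges of the path lie.\<close>

lemma descending_path:
  fixes D :: "'a::{finite,order} \<Rightarrow> complex"
  assumes pd: "planar_diagram D" and "c \<lessdot> x" "w \<le> c"
  obtains f :: "real \<Rightarrow> real" where
    "continuous_on {Im (D w)..Im (D x)} f"
    "f (Im (D w)) = Re (D w)"
    "\<And>h. h \<in> {Im (D c)..Im (D x)} \<Longrightarrow> f h = Re (D x) + slope D x c * (Im (D x) - h)"
    "\<And>h. h \<in> {Im (D w)..Im (D x)} \<Longrightarrow>
       \<exists>a b. a \<lessdot> b \<and> w \<le> a \<and> (b \<le> c \<or> a = c \<and> b = x) \<and>
             Complex (f h) h \<in> closed_segment (D a) (D b)"
proof -
  have "\<exists>f :: real \<Rightarrow> real.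
    continuous_on {Im (D w)..Im (D x)} f \<and> f (Im (D w)) = Re (D w) \<and>
    (\<forall>h \<in> {Im (D c)..Im (D x)}. f h = Re (D x) + slope D x c * (Im (D x) - h)) \<and>
    (\<forall>h \<in> {Im (D w)..Im (D x)}.
       \<exists>a b. a \<lessdot> b \<and> w \<le> a \<and> (b \<le> c \<or> a = c \<and> b = x) \<and>
             Complex (f h) h \<in> closed_segment (D a) (D b))"
    using assms(2,3)
  proof (induction c arbitrary: x rule: finite_order_induct)
    case (less c)
    let ?l = "\<lambda>h. Re (D x) + slope D x c * (Im (D x) - h)"
    have im: "Im (D c) < Im (D x)" using Im_diagram_strict[OF pd coveredD[OF less.prems(1)]] .
    have lc: "?l (Im (D c)) = Re (D c)" using im by (simp add: slope_def)
    have cl: "continuous_on A ?l" for A by (intro continuous_intros)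
    show ?case
    proof (cases "w = c")
      case True
      have "\<exists>a b. a \<lessdot> b \<and> c \<le> a \<and> (b \<le> c \<or> a = c \<and> b = x) \<and>
             Complex (?l h) h \<in> closed_segment (D a) (D b)" if "h \<in> {Im (D c)..Im (D x)}" for h
        using on_edge[of D c x h, OF im that] less.prems(1) by (intro exI[of _ c] exI[of _ x]) simp
      then show ?thesis unfolding True using lc cl by (intro exI[of _ ?l] conjI) simp_all
    next
      case False
      then obtain d where d: "w \<le> d" "d \<lessdot> c" using less.prems by (metis covered_below order_le_less)
      from less.IH[OF coveredD[OF d(2)] d(2,1)] obtain g where
        g: "continuous_on {Im (D w)..Im (D c)} g" "g (Im (D w)) = Re (D w)"
        "\<forall>h \<in> {Im (D d)..Im (D c)}. g h = Re (D c) + slope D c d * (Im (D c) - h)"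
        "\<forall>h \<in> {Im (D w)..Im (D c)}.
           \<exists>a b. a \<lessdot> b \<and> w \<le> a \<and> (b \<le> d \<or> a = d \<and> b = c) \<and>
             Complex (g h) h \<in> closed_segment (D a) (D b)"
        by blast
      have imd: "Im (D d) < Im (D c)" using Im_diagram_strict[OF pd coveredD[OF d(2)]] .
      have imw: "Im (D w) \<le> Im (D c)" using Im_diagram_mono[OF pd less.prems(2)] .
      have gc: "g (Im (D c)) = Re (D c)" using g(3) imd by simp
      \<comment> \<open>The path from \<open>c\<close> downwards, given by induction, is glued to
        the edge from \<open>c\<close> to \<open>x\<close>; both pass through
        \<open>D c\<close>.\<close>
      let ?f = "\<lambda>h. if h \<le> Im (D c) then g h else ?l h"
      have un: "{Im (D w)..Im (D x)} = {Im (D w)..Im (D c)} \<union> {Im (D c)..Im (D x)}"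
        using imw im by auto
      have "continuous_on {Im (D w)..Im (D x)} ?f"
        unfolding un by (rule continuous_on_cases) (use g cl gc lc in auto)
      moreover have "?f (Im (D w)) = Re (D w)" using g imw by simp
      moreover have "\<forall>h \<in> {Im (D c)..Im (D x)}. ?f h = ?l h" using gc lc by auto
      moreover have "\<exists>a b. a \<lessdot> b \<and> w \<le> a \<and> (b \<le> c \<or> a = c \<and> b = x) \<and>
             Complex (?f h) h \<in> closed_segment (D a) (D b)" if "h \<in> {Im (D w)..Im (D x)}" for h
      proof (cases "h \<le> Im (D c)")
        case True
        then obtain a b where "a \<lessdot> b" "w \<le> a" "b \<le> d \<or> a = d \<and> b = c"
             "Complex (g h) h \<in> closed_segment (D a) (D b)"
          using g(4) \<open>h \<in> {Im (D w)..Im (D x)}\<close> by (metis atLeastAtMost_iff)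
        moreover have "b \<le> c" using calculation(3) coveredD[OF d(2)] by auto
        ultimately show ?thesis using True by auto
      next
        case False
        then show ?thesis using on_edge[of D c x h] im that less.prems
          by (intro exI[of _ c] exI[of _ x]) auto
      qed
      ultimately show ?thesis by blast
    qed
  qed
  then show thesis using that by blast
qed

text \<open>A path descending through the middle lower cover is squeezed between two paths that meet at
  \<^term>\<open>inf a b\<close>, hence it meets one of them, and by planarity it does so in an element.\<close>

lemma inf_le_middle_coatom:
  fixes D :: "'a::{finite,lattice} \<Rightarrow> complex"
  assumes pd: "planar_diagram D"
    and cov: "a \<lessdot> x" "c \<lessdot> x" "b \<lessdot> x"
    and sl: "slope D x a < slope D x c" "slope D x c < slope D x b"
  shows "inf a b \<le> c"
proof -
  define u where "u = inf a b"
  have "u \<le> a" "u \<le> b" by (auto simp: u_def)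
  obtain fa where fa:
    "continuous_on {Im (D u)..Im (D x)} fa"
    "fa (Im (D u)) = Re (D u)"
    "\<And>h. h \<in> {Im (D a)..Im (D x)} \<Longrightarrow> fa h = Re (D x) + slope D x a * (Im (D x) - h)"
    "\<And>h. h \<in> {Im (D u)..Im (D x)} \<Longrightarrow>
       \<exists>p q. p \<lessdot> q \<and> u \<le> p \<and> (q \<le> a \<or> p = a \<and> q = x) \<and>
             Complex (fa h) h \<in> closed_segment (D p) (D q)"
    using descending_path[OF pd cov(1) \<open>u \<le> a\<close>] by blast
  obtain fb where fb:
    "continuous_on {Im (D u)..Im (D x)} fb"
    "fb (Im (D u)) = Re (D u)"
    "\<And>h. h \<in> {Im (D b)..Im (D x)} \<Longrightarrow> fb h = Re (D x) + slope D x b * (Im (D x) - h)"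
    "\<And>h. h \<in> {Im (D u)..Im (D x)} \<Longrightarrow>
       \<exists>p q. p \<lessdot> q \<and> u \<le> p \<and> (q \<le> b \<or> p = b \<and> q = x) \<and>
             Complex (fb h) h \<in> closed_segment (D p) (D q)"
    using descending_path[OF pd cov(3) \<open>u \<le> b\<close>] by blast
  \<comment> \<open>Whether \<open>u\<close> is below \<open>c\<close> is still open, so this path
    descends to \<open>inf u c\<close>; it then reaches every height between \<open>D u\<close> and
    \<open>D x\<close>.\<close>
  obtain fc where fc:
    "continuous_on {Im (D (inf u c))..Im (D x)} fc"
    "fc (Im (D (inf u c))) = Re (D (inf u c))"
    "\<And>h. h \<in> {Im (D c)..Im (D x)} \<Longrightarrow> fc h = Re (D x) + slope D x c * (Im (D x) - h)"
    "\<And>h. h \<in> {Im (D (inf u c))..Im (D x)} \<Longrightarrow>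
       \<exists>p q. p \<lessdot> q \<and> inf u c \<le> p \<and> (q \<le> c \<or> p = c \<and> q = x) \<and>
             Complex (fc h) h \<in> closed_segment (D p) (D q)"
    using descending_path[OF pd cov(2) inf_le2] by blast
  have imuc: "Im (D (inf u c)) \<le> Im (D u)" using Im_diagram_mono[OF pd inf_le1] .
  \<comment> \<open>At height \<open>k\<close> all three paths still run on their edges to
    \<open>x\<close>, so their left-to-right order there is that of the slopes.\<close>
  define k where "k = max (Im (D a)) (max (Im (D b)) (Im (D c)))"
  have k: "Im (D a) \<le> k" "Im (D b) \<le> k" "Im (D c) \<le> k" by (auto simp: k_def)
  have kx: "k < Im (D x)"
    using Im_diagram_strict[OF pd] cov coveredD unfolding k_def by simp blast
  have uk: "Im (D u) \<le> k" using Im_diagram_mono[OF pd \<open>u \<le> a\<close>] k by simp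
  have top: "fa k < fc k" "fc k < fb k"
    using fa(3)[of k] fb(3)[of k] fc(3)[of k] k kx sl by auto
  \<comment> \<open>The middle path meets an edge whose lower end is above \<open>u\<close>. By
    planarity that edge belongs to the middle path or shares an element with it; either way some
    element is above \<open>u\<close> and below \<open>c\<close>. Heights below \<open>D x\<close>
    exclude the common starting point.\<close>
  have meet: "u \<le> c"
    if h: "Im (D u) \<le> h" "h < Im (D x)" and pq: "p \<lessdot> q" "u \<le> p"
      and P: "Complex (fc h) h \<in> closed_segment (D p) (D q)" for h p q
  proof -
    obtain r s where rs: "r \<lessdot> s" "s \<le> c \<or> r = c \<and> s = x"
        "Complex (fc h) h \<in> closed_segment (D r) (D s)"
      using fc(4)[of h] h imuc by auto
    have "r \<le> c" using rs(1,2) coveredD[of r s] by auto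
    from pd pq(1) rs(1) P rs(3) show ?thesis
    proof (rule diagram_edges_meet)
      assume "p = r"
      then show ?thesis using \<open>r \<le> c\<close> pq by simp
    next
      fix e assume e: "Complex (fc h) h = D e" "e \<in> {p, q}" "e \<in> {r, s}"
      have "Im (D e) = h" using e(1) by (metis complex.sel(2))
      then have "e \<noteq> x" using h by auto
      then have "e \<le> c" using e(3) rs(2) \<open>r \<le> c\<close> by auto
      moreover have "u \<le> e" using e(2) pq coveredD[of p q] by auto
      ultimately show ?thesis by simp
    qed
  qed
  have cont: "continuous_on {Im (D u)..k} fa" "continuous_on {Im (D u)..k} fb" "continuous_on {Im (D u)..k} fc"
    by (rule continuous_on_subset[OF fa(1)] continuous_on_subset[OF fb(1)] continuous_on_subset[OF fc(1)];
        use imuc kx in auto)+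
  \<comment> \<open>Both outer paths end in \<open>D u\<close>. If the middle path is not to the
    right of \<open>D u\<close> at that height, it meets \<open>fa\<close> on its way down from
    height \<open>k\<close>; if it is not to the left, it meets \<open>fb\<close>.\<close>
  consider "fc (Im (D u)) \<le> Re (D u)" | "Re (D u) \<le> fc (Im (D u))" by linarith
  then have "u \<le> c"
  proof cases
    case 1
    have "\<exists>h\<ge>Im (D u). h \<le> k \<and> (\<lambda>h. fc h - fa h) h = 0"
      by (rule IVT') (use 1 fa(2) top uk in \<open>auto intro!: continuous_on_diff cont\<close>)
    then obtain h where h: "Im (D u) \<le> h" "h \<le> k" "fc h = fa h" by auto
    then obtain p q where "p \<lessdot> q" "u \<le> p" "Complex (fc h) h \<in> closed_segment (D p) (D q)"
      using fa(4)[of h] kx by auto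
    then show ?thesis using meet h kx by auto
  next
    case 2
    have "\<exists>h\<ge>Im (D u). h \<le> k \<and> (\<lambda>h. fb h - fc h) h = 0"
      by (rule IVT') (use 2 fb(2) top uk in \<open>auto intro!: continuous_on_diff cont\<close>)
    then obtain h where h: "Im (D u) \<le> h" "h \<le> k" "fb h = fc h" by auto
    then obtain p q where "p \<lessdot> q" "u \<le> p" "Complex (fc h) h \<in> closed_segment (D p) (D q)"
      using fb(4)[of h] kx by auto
    then show ?thesis using meet h kx by auto
  qed
  then show ?thesis by (simp add: u_def)
qed


section \<open>Covering squares in a planar diagram\<close>

text \<open>By connectedness the edge meets the boundary \<open>Q\<close>. As \<open>D c\<close> is
  off \<open>Q\<close>, the edge is not a side of the square, so planarity lets it meet a side only
  in a common end; this end is not \<open>c\<close>, hence it is \<open>d\<close>.\<close>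

lemma edge_leaving_square:
  fixes D :: "'a::{finite,order} \<Rightarrow> complex"
  assumes pd: "planar_diagram D"
    and sq: "u \<lessdot> v" "v \<lessdot> i" "u \<lessdot> w" "w \<lessdot> i"
    and Q: "Q = closed_segment (D u) (D v) \<union> closed_segment (D v) (D i) \<union>
                closed_segment (D u) (D w) \<union> closed_segment (D w) (D i)"
    and cd: "c \<lessdot> d \<or> d \<lessdot> c"
    and c: "D c \<in> inside Q" and d: "D d \<notin> inside Q"
  shows "d \<in> {u, v, w, i}"
proof -
  let ?s = "closed_segment (D c) (D d)"
  obtain p q where pq: "p \<lessdot> q" "{p, q} = {c, d}" "?s = closed_segment (D p) (D q)"
    using cd closed_segment_commute by (metis insert_commute)
  have cQ: "D c \<notin> Q" using c inside_no_overlap by blast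
  have "?s \<inter> Q \<noteq> {}"
  proof
    assume "?s \<inter> Q = {}"
    then have "?s \<subseteq> - Q" by auto
    then have "connected_component (- Q) (D c) (D d)"
      unfolding connected_component_def by (intro exI[of _ ?s]) auto
    then show False using inside_same_component c d by blast
  qed
  then obtain P where P: "P \<in> ?s" "P \<in> Q" by blast
  then obtain a b where ab: "a \<lessdot> b" "P \<in> closed_segment (D a) (D b)"
      "closed_segment (D a) (D b) \<subseteq> Q" "{a, b} \<subseteq> {u, v, w, i}"
    using sq unfolding Q by blast
  from pd pq(1) ab(1) P(1)[unfolded pq(3)] ab(2) show ?thesis
  proof (rule diagram_edges_meet)
    assume "p = a" "q = b"
    then have "D c \<in> Q" using ab(3) pq(3) ends_in_segment(1) by blast
    then show ?thesis using cQ by blast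
  next
    fix e assume e: "P = D e" "e \<in> {p, q}" "e \<in> {a, b}"
    then have "e \<noteq> c" using P cQ by blast
    then show ?thesis using e pq(2) ab(4) by auto
  qed
qed

text \<open>Climb from \<open>z\<close> to a maximal element \<open>y\<close> drawn inside the
  square: an upper cover of \<open>y\<close> is no longer inside, so it is a corner and lies below
  \<open>i\<close>. Descending gives \<open>u\<close> in the same way.\<close>

lemma inside_square_between:
  fixes D :: "'a::{finite,lattice} \<Rightarrow> complex"
  assumes pd: "planar_diagram D"
    and sq: "u \<lessdot> v" "v \<lessdot> i" "u \<lessdot> w" "w \<lessdot> i"
    and z: "D z \<in> inside (closed_segment (D u) (D v) \<union> closed_segment (D v) (D i) \<union>
                closed_segment (D u) (D w) \<union> closed_segment (D w) (D i))"
  shows "u < z" "z < i" "z \<noteq> v" "z \<noteq> w"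
proof -
  define Q where "Q = closed_segment (D u) (D v) \<union> closed_segment (D v) (D i) \<union>
                closed_segment (D u) (D w) \<union> closed_segment (D w) (D i)"
  note leave = edge_leaving_square[OF pd sq Q_def]
  have zQ: "D z \<in> inside Q" using z by (simp add: Q_def)
  then have "D z \<notin> Q" using inside_no_overlap by blast
  then have ne: "z \<noteq> u" "z \<noteq> v" "z \<noteq> w" "z \<noteq> i" by (auto simp: Q_def)
  have le: "u \<le> v" "v \<le> i" "u \<le> w" "w \<le> i" using sq coveredD less_imp_le by blast+
  note im = le[THEN Im_diagram_mono[OF pd]]
  \<comment> \<open>The square lies in a closed half-plane bounded by the height of
    \<open>D i\<close>; by convexity all points beyond that half-plane are outside.\<close>
  have "Q \<subseteq> {p. Im p \<le> Im (D i)}"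
    unfolding Q_def using im
    by (intro Un_least closed_segment_subset convex_halfspace_Im_le) auto
  from outside_subset_convex[OF convex_halfspace_Im_le this] have up: "inside Q \<subseteq> {p. Im p \<le> Im (D i)}"
    using inside_Int_outside[of Q] by blast
  have "Q \<subseteq> {p. Im p \<ge> Im (D u)}"
    unfolding Q_def using im
    by (intro Un_least closed_segment_subset convex_halfspace_Im_ge) auto
  from outside_subset_convex[OF convex_halfspace_Im_ge this] have down: "inside Q \<subseteq> {p. Im p \<ge> Im (D u)}"
    using inside_Int_outside[of Q] by blast
  have uiQ: "D u \<in> Q" "D i \<in> Q" by (auto simp: Q_def)
  have "z \<le> i"
  proof -
    let ?A = "{y. z \<le> y \<and> D y \<in> inside Q}"
    have "finite ?A" "?A \<noteq> {}" using zQ by auto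
    from finite_has_maximal[OF this] obtain y where
      y: "z \<le> y" "D y \<in> inside Q" "\<And>t. z \<le> t \<Longrightarrow> D t \<in> inside Q \<Longrightarrow> y \<le> t \<Longrightarrow> y = t"
      by blast
    \<comment> \<open>Its height keeps \<open>y\<close> from being above \<open>i\<close>, so
      \<open>y\<close> is not the greatest element and does have an upper cover.\<close>
    have "y \<noteq> i" using y(2) uiQ inside_no_overlap by blast
    moreover have "Im (D y) \<le> Im (D i)" using y(2) up by blast
    then have "\<not> i < y" using Im_diagram_strict[OF pd, of i y] by linarith
    ultimately have "\<not> i \<le> y" by (metis order_le_less)
    then have "y < sup y i" by (metis order_le_less sup.cobounded1 sup.cobounded2)
    then obtain d where d: "y \<lessdot> d" by (meson covered_above)
    then have "D d \<notin> inside Q" using y coveredD by (metis less_imp_le less_irrefl order.trans)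
    then have "d \<in> {u, v, w, i}" using leave d y(2) by blast
    then have "d \<le> i" using le by auto
    then show ?thesis using y(1) d coveredD by (meson less_imp_le order.trans)
  qed
  moreover have "u \<le> z"
  proof -
    let ?A = "{y. y \<le> z \<and> D y \<in> inside Q}"
    have "finite ?A" "?A \<noteq> {}" using zQ by auto
    from finite_has_minimal[OF this] obtain y where
      y: "y \<le> z" "D y \<in> inside Q" "\<And>t. t \<le> z \<Longrightarrow> D t \<in> inside Q \<Longrightarrow> t \<le> y \<Longrightarrow> y = t"
      by blast
    have "y \<noteq> u" using y(2) uiQ inside_no_overlap by blast
    moreover have "Im (D u) \<le> Im (D y)" using y(2) down by blast
    then have "\<not> y < u" using Im_diagram_strict[OF pd, of y u] by linarith
    ultimately have "\<not> y \<le> u" by (metis order_le_less)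
    then have "inf y u < y" by (metis order_le_less inf.cobounded1 inf.cobounded2)
    then obtain d where d: "d \<lessdot> y" by (meson covered_below)
    then have "D d \<notin> inside Q" using y coveredD by (metis less_imp_le less_irrefl order.trans)
    then have "d \<in> {u, v, w, i}" using leave d y(2) by blast
    then have "u \<le> d" using le by auto
    then show ?thesis using y(1) d coveredD by (meson less_imp_le order.trans)
  qed
  ultimately show "u < z" "z < i" "z \<noteq> v" "z \<noteq> w" using ne by auto
qed

section \<open>Sets of prime intervals that are collapsed by a congruence\<close>

text \<open>Separates the order theory from the geometry: \<open>s x\<close> ranks the lower covers
  of \<open>x\<close> as the slopes do, and \<open>R\<close> stands for the set of reachable prime
  intervals. \<open>R_swing\<close> covers switches (\<open>inf a c = inf b c\<close>) as well as
  swings.\<close>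

locale swing_closed = semimodular type
  for type :: "'a::{finite,lattice} itself" +
  fixes s :: "'a \<Rightarrow> 'a \<Rightarrow> real" and R :: "'a rel"
  assumes s_inj: "c \<lessdot> x \<Longrightarrow> d \<lessdot> x \<Longrightarrow> s x c = s x d \<Longrightarrow> c = d"
    and s_mid: "a \<lessdot> x \<Longrightarrow> c \<lessdot> x \<Longrightarrow> b \<lessdot> x \<Longrightarrow> s x a < s x c \<Longrightarrow> s x c < s x b \<Longrightarrow> inf a b \<le> c"
    and R_covered: "(a, b) \<in> R \<Longrightarrow> a \<lessdot> b"
    and R_square: "u \<lessdot> v \<Longrightarrow> v \<lessdot> i \<Longrightarrow> u \<lessdot> w \<Longrightarrow> w \<lessdot> i \<Longrightarrow> v \<noteq> w \<Longrightarrow> (u, v) \<in> R \<longleftrightarrow> (w, i) \<in> R"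
    and R_swing: "a \<lessdot> x \<Longrightarrow> c \<lessdot> x \<Longrightarrow> b \<lessdot> x \<Longrightarrow> a \<noteq> c \<Longrightarrow> b \<noteq> c \<Longrightarrow> a \<noteq> b \<Longrightarrow>
      inf a c \<lessdot> c \<Longrightarrow> inf b c \<lessdot> c \<Longrightarrow> inf a b \<le> c \<Longrightarrow> (a, x) \<in> R \<Longrightarrow> (c, x) \<in> R"
begin

text \<open>Symmetric in \<open>a\<close> and \<open>b\<close>, because the lower covers supplied by
  \<open>third_coatom\<close> may lie on either side.\<close>

definition between :: "'a \<Rightarrow> 'a \<Rightarrow> 'a \<Rightarrow> 'a \<Rightarrow> bool" where
  "between x a c b \<longleftrightarrow> a \<lessdot> x \<and> c \<lessdot> x \<and> b \<lessdot> x \<and>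
     (s x a < s x c \<and> s x c < s x b \<or> s x b < s x c \<and> s x c < s x a)"

lemma between_inf_le: "between x a c b \<Longrightarrow> inf a b \<le> c"
  unfolding between_def using s_mid by (metis inf.commute)

lemma between_cases:
  assumes "a \<lessdot> x" "c \<lessdot> x" "b \<lessdot> x" "a \<noteq> c" "b \<noteq> c" "a \<noteq> b"
  shows "between x a c b \<or> between x c a b \<or> between x a b c"
proof -
  have "s x a \<noteq> s x c" "s x b \<noteq> s x c" "s x a \<noteq> s x b" using assms s_inj by blast+
  then show ?thesis using assms(1-3) unfolding between_def by linarith
qed

lemma card_between_less:
  assumes "between x a c b"
  shows "card {d. between x a d c} < card {d. between x a d b}"
  using assms by (intro psubset_card_mono; auto simp: between_def; force)

lemma third_coatom_between:
  assumes "y \<lessdot> x" "z \<lessdot> x" "y \<noteq> z" "\<not> inf y z \<lessdot> z"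
  obtains c where "between x y c z" "inf c z \<lessdot> z"
proof -
  obtain c where c: "c \<lessdot> x" "c \<noteq> y" "c \<noteq> z" "inf c z \<lessdot> z" "\<not> inf c y \<le> z" "\<not> inf c z \<le> y"
    using third_coatom[OF assms] by blast
  have "\<not> between x c y z" "\<not> between x y z c"
    using between_inf_le c(5,6) by (metis inf.commute)+
  then have "between x y c z" using between_cases[of y x c z] assms c by auto
  with c that show thesis by blast
qed

text \<open>\<open>R_swing\<close> applies at \<open>c\<close> once there are neighbours
  \<open>y'\<close> and \<open>z'\<close> on its two sides that span covering squares with
  \<open>c\<close>. If \<open>y\<close> does not serve as \<open>y'\<close>,
  \<open>third_coatom_between\<close> gives one between \<open>y\<close> and \<open>c\<close>, and
  it is in \<open>R\<close> by induction. On the other side nothing about \<open>R\<close> is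
  required.\<close>

lemma between_closed:
  assumes "between x y c z" "(y, x) \<in> R"
  shows "(c, x) \<in> R"
  using assms(1)
proof (induction "card {d. between x y d c}" arbitrary: c rule: less_induct)
  case less
  have cov: "y \<lessdot> x" "c \<lessdot> x" "z \<lessdot> x" "y \<noteq> c" "z \<noteq> c" "y \<noteq> z"
    using less.prems by (auto simp: between_def)
  obtain y' where y': "between x y' c z" "inf y' c \<lessdot> c" "(y', x) \<in> R"
  proof (cases "inf y c \<lessdot> c")
    case True
    then show ?thesis using that less.prems assms(2) by blast
  next
    case False
    then obtain y' where y': "between x y y' c" "inf y' c \<lessdot> c"
      using third_coatom_between cov by metis
    have "between x y y' z" "between x y' c z"
      using y'(1) less.prems by (auto simp: between_def)
    then show ?thesis using that y' less.hyps card_between_less[OF y'(1)] by blast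
  qed
  obtain z' where z': "between x y' c z'" "inf z' c \<lessdot> c"
  proof (cases "inf z c \<lessdot> c")
    case True
    then show ?thesis using that y'(1) by blast
  next
    case False
    then obtain z' where z': "between x z z' c" "inf z' c \<lessdot> c"
      using third_coatom_between cov by metis
    have "between x y' c z'"
      using z'(1) y'(1) by (auto simp: between_def)
    then show ?thesis using that z' by blast
  qed
  show ?case
    by (rule R_swing[of y' x c z'])
      (use y' z' between_inf_le[OF z'(1)] in \<open>auto simp: between_def\<close>)
qed

section \<open>Stability of \<open>R\<close>-chains under joins and restriction to
  subintervals\<close>

lemma R_le: "(a, b) \<in> R \<Longrightarrow> a \<le> b"
  using R_covered coveredD less_imp_le by blast

text \<open>The interval is moved up along a chain of covers from \<open>a\<close> to
  \<open>sup a c\<close>. Each link \<open>d\<close>, \<open>e\<close> spans a covering square with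
  \<open>sup b d\<close>, unless \<open>b\<close> is already below \<open>e\<close>, after which the
  interval stays trivial.\<close>

lemma R_up:
  assumes "(a, b) \<in> R"
  shows "(sup a c, sup b c) \<in> R \<or> sup a c = sup b c"
proof -
  have *: "(d, sup b d) \<in> R \<or> d = sup b d" if "(a, d) \<in> {(x, y). x \<lessdot> y}\<^sup>*" for d
    using that
  proof (induction rule: rtrancl_induct)
    case base
    then show ?case using assms R_le[OF assms] by (simp add: sup.absorb1)
  next
    case (step d e)
    then have de: "d \<lessdot> e" "d \<le> e" using coveredD less_imp_le by auto
    show ?case
    proof (cases "b \<le> e")
      case True
      then show ?thesis by (simp add: sup.absorb2)
    next
      case False
      then have "sup b d \<noteq> d" "sup b d \<noteq> e"
        using de(2) by (metis order.trans sup.cobounded1)+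
      moreover have "(d, sup b d) \<in> R" using step.IH \<open>sup b d \<noteq> d\<close> by simp
      moreover have "sup (sup b d) e = sup b e" using de(2) by (simp add: sup.assoc sup.absorb2)
      ultimately show ?thesis
        using R_square[of d "sup b d" "sup b e" e] atoms_sup_covered[of d "sup b d" e] R_covered de(1)
        by metis
    qed
  qed
  have "sup b (sup a c) = sup b c" using R_le[OF assms] by (simp add: sup.assoc[symmetric] sup.absorb1)
  then show ?thesis using *[OF covered_chain[of a "sup a c"]] by auto
qed

text \<open>The converse movement: since \<open>b\<close> is not below \<open>d\<close>, every link
  of a chain from \<open>a\<close> to \<open>d\<close> spans a covering square, and membership in
  \<open>R\<close> passes down through these squares.\<close>

lemma R_down:
  assumes "a \<lessdot> b" "a \<le> d" "\<not> b \<le> d" "(d, sup b d) \<in> R"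
  shows "(a, b) \<in> R"
proof -
  have "a \<le> d \<and> (\<not> b \<le> d \<longrightarrow> (d, sup b d) \<in> R \<longrightarrow> (a, b) \<in> R)"
    using covered_chain[OF assms(2)]
  proof (induction rule: rtrancl_induct)
    case base
    then show ?case using coveredD[OF assms(1)] by (simp add: sup.absorb1)
  next
    case (step d e)
    then have de: "d \<lessdot> e" "d \<le> e" "a \<le> d" using coveredD less_imp_le by auto
    have "(a, b) \<in> R" if h: "\<not> b \<le> e" "(e, sup b e) \<in> R"
    proof -
      have "\<not> b \<le> d" using h(1) de(2) order.trans by blast
      moreover have "d \<lessdot> sup b d"
        using sup_covered[OF assms(1), of d] de(3) calculation
        by (metis sup.absorb2 sup.cobounded1)
      moreover have "sup b d \<noteq> e" using h(1) by auto
      moreover have "sup (sup b d) e = sup b e" using de(2) by (simp add: sup.assoc sup.absorb2)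
      ultimately show ?thesis
        using R_square[of d "sup b d" "sup b e" e] atoms_sup_covered[of d "sup b d" e] de(1) h step.IH
        by metis
    qed
    then show ?case using de by auto
  qed
  then show ?thesis using assms by blast
qed

text \<open>Joined with \<open>c\<close>, the chain starts at \<open>c\<close> and ends above
  \<open>d\<close>. The link at which it first gets above \<open>d\<close> is in \<open>R\<close> by
  \<open>R_up\<close> and is the interval from \<open>c\<close> to \<open>d\<close> moved up, so
  \<open>R_down\<close> applies.\<close>

lemma R_rtrancl_covered:
  assumes "(a, b) \<in> R\<^sup>*" "a \<le> c" "c \<lessdot> d" "d \<le> b"
  shows "(c, d) \<in> R"
proof -
  have "d \<le> sup b c \<longrightarrow> (c, d) \<in> R"
    using assms(1)
  proof (induction rule: rtrancl_induct)
    case base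
    then show ?case using assms(2) coveredD[OF assms(3)] by (simp add: sup.absorb2 less_le_not_le)
  next
    case (step b b')
    show ?case
    proof (intro impI, cases "d \<le> sup b c")
      case True
      then show "(c, d) \<in> R" using step.IH by blast
    next
      case False
      assume d: "d \<le> sup b' c"
      then have R: "(sup b c, sup b' c) \<in> R" using R_up[OF step.hyps(2), of c] False by auto
      have "sup d (sup b c) = sup b' c"
        using covered_between[OF R_covered[OF R], of "sup d (sup b c)"] False d R_le[OF R]
        by (metis le_sup_iff sup.cobounded1 sup.cobounded2)
      then show "(c, d) \<in> R" using R_down[of c d "sup b c"] assms(3) False R by simp
    qed
  qed
  then show ?thesis using assms(4) le_supI1 by blast
qed

lemma R_rtrancl_mono:
  assumes "(a, b) \<in> R\<^sup>*" "a \<le> c" "c \<le> d" "d \<le> b"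
  shows "(c, d) \<in> R\<^sup>*"
proof -
  have "c \<le> d \<and> (d \<le> b \<longrightarrow> (c, d) \<in> R\<^sup>*)"
    using covered_chain[OF assms(3)]
  proof (induction rule: rtrancl_induct)
    case (step d e)
    then have "d \<le> e" "d \<lessdot> e" using coveredD less_imp_le by auto
    then show ?case using step.IH R_rtrancl_covered[OF assms(1), of d e] assms(2)
      by (meson order.trans rtrancl_into_rtrancl)
  qed simp
  then show ?thesis using assms(4) by blast
qed

lemma R_rtrancl_sup: "(a, b) \<in> R\<^sup>* \<Longrightarrow> (sup a c, sup b c) \<in> R\<^sup>*"
proof (induction rule: rtrancl_induct)
  case (step b b')
  then show ?case using R_up[of b b' c] by (metis rtrancl_into_rtrancl)
qed simp

text \<open>If \<open>y\<close> and \<open>z\<close> span no covering square, take \<open>c\<close>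
  between them that spans one with \<open>z\<close>. The chain from \<open>inf y c\<close> to
  \<open>c\<close>, met with \<open>z\<close>, leads from \<open>inf y z\<close> to
  \<open>inf c z\<close>, because \<open>inf y z\<close> is below \<open>c\<close>; the last link,
  to \<open>z\<close>, comes from \<open>between_closed\<close>. \<open>IH\<close> is the part of
  \<open>R_rtrancl_inf\<close> already available in its induction.\<close>

lemma R_coatom_inf:
  assumes IH: "\<And>b a c. b < x \<Longrightarrow> (a, b) \<in> R\<^sup>* \<Longrightarrow> (inf a c, inf b c) \<in> R\<^sup>*"
    and y: "(y, x) \<in> R" and "z \<lessdot> x" "y \<noteq> z"
  shows "(inf y z, z) \<in> R\<^sup>*"
  using assms(3,4)
proof (induction "card {d. between x y d z}" arbitrary: z rule: less_induct)
  case less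
  have yx: "y \<lessdot> x" using R_covered[OF y] .
  show ?case
  proof (cases "inf y z \<lessdot> z")
    case True
    then have "inf y z \<lessdot> y" using coatoms_inf_covered_commute[OF yx] less.prems by blast
    then have "(inf y z, z) \<in> R" using R_square[of "inf y z" z x y] True yx y less.prems by blast
    then show ?thesis by blast
  next
    case False
    then obtain c where c: "between x y c z" "inf c z \<lessdot> z"
      using third_coatom_between yx less.prems by metis
    have cx: "c \<lessdot> x" "y \<noteq> c" "c \<noteq> z" using c(1) by (auto simp: between_def)
    have "(inf y c, c) \<in> R\<^sup>*" using less.hyps[OF card_between_less[OF c(1)] cx(1,2)] .
    then have "(inf (inf y c) z, inf c z) \<in> R\<^sup>*" using IH coveredD[OF cx(1)] by blast
    moreover have "inf (inf y c) z = inf y z"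
      using between_inf_le[OF c(1)] by (metis inf.absorb1 inf.assoc inf.commute)
    moreover have "(inf c z, z) \<in> R"
    proof -
      have "inf c z \<lessdot> c" using coatoms_inf_covered_commute[OF cx(1)] less.prems(1) c(2) cx by blast
      then show ?thesis
        using R_square[of "inf c z" z x c] c(2) cx less.prems(1) between_closed[OF c(1) y] by blast
    qed
    ultimately show ?thesis by (metis rtrancl_into_rtrancl)
  qed
qed

text \<open>Induction on the top \<open>b\<close>, splitting off the last link from
  \<open>y\<close>. If \<open>inf b c\<close> is not \<open>b\<close>, it is below some lower cover
  \<open>z\<close> of \<open>b\<close>; for \<open>z\<close> other than \<open>y\<close>, the chain
  from \<open>inf y z\<close> to \<open>z\<close> is met with \<open>inf b c\<close> by the
  induction hypothesis for \<open>z\<close>.\<close>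

lemma R_rtrancl_inf: "(a, b) \<in> R\<^sup>* \<Longrightarrow> (inf a c, inf b c) \<in> R\<^sup>*"
proof (induction b arbitrary: a c rule: finite_order_induct)
  case (less b)
  from less.prems show ?case
  proof (cases rule: rtranclE)
    case base
    then show ?thesis by simp
  next
    case (step y)
    have yb: "y \<lessdot> b" using R_covered step(2) .
    have "(inf a c, inf y c) \<in> R\<^sup>*" using less.IH[OF coveredD[OF yb] step(1)] .
    moreover have "(inf y c, inf b c) \<in> R\<^sup>*"
    proof -
      define e where "e = inf b c"
      have ye: "inf y c = inf y e" using R_le[OF step(2)]
        by (metis e_def inf.absorb1 inf.assoc)
      have "e \<le> b" by (simp add: e_def)
      show ?thesis
      proof (cases "e = b")
        case True
        then have "inf y e = y" using R_le[OF step(2)] by (simp add: inf.absorb1)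
        then show ?thesis using True ye step(2) e_def by (metis r_into_rtrancl)
      next
        case False
        then obtain z where z: "e \<le> z" "z \<lessdot> b" using \<open>e \<le> b\<close> by (metis covered_below order_le_less)
        show ?thesis
        proof (cases "y = z")
          case True
          then have "inf y e = e" using z by (simp add: inf.absorb2)
          then show ?thesis using ye e_def by simp
        next
          case False
          have "(inf y z, z) \<in> R\<^sup>*"
            using R_coatom_inf[OF less.IH step(2) z(2) False] by blast
          then have "(inf (inf y z) e, inf z e) \<in> R\<^sup>*" using less.IH coveredD[OF z(2)] by blast
          moreover have "inf z e = e" using z by (simp add: inf.absorb2)
          ultimately show ?thesis using ye e_def by (simp add: inf.assoc)
        qed
      qed
    qed
    ultimately show ?thesis by (rule rtrancl_trans)
  qed
qed

text \<open>For transitivity, the chain of \<open>(a, b)\<close> is met with \<open>inf b c\<close>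
  and joined with \<open>sup b c\<close>; around the chain of \<open>(b, c)\<close> this gives one
  long chain, which \<open>R_rtrancl_mono\<close> cuts down. Compatibility is shown in one argument
  at a time and combined by transitivity.\<close>

lemma lattice_congruence_R: "lattice_congruence {(a, b). (inf a b, sup a b) \<in> R\<^sup>*}"
proof -
  let ?T = "{(a, b). (inf a b, sup a b) \<in> R\<^sup>*}"
  have tr: "(a, c) \<in> ?T" if "(a, b) \<in> ?T" "(b, c) \<in> ?T" for a b c
  proof -
    have 1: "(inf a b, sup a b) \<in> R\<^sup>*" "(inf b c, sup b c) \<in> R\<^sup>*" using that by auto
    have "(inf (inf a b) (inf b c), inf b c) \<in> R\<^sup>*"
      using R_rtrancl_inf[OF 1(1), of "inf b c"] by (simp add: inf.absorb2 le_infI1 le_supI2)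
    also note 1(2)
    also have "(sup b c, sup (sup a b) (sup b c)) \<in> R\<^sup>*"
      using R_rtrancl_sup[OF 1(1), of "sup b c"] by (simp add: sup.absorb2 le_infI2 le_supI1)
    finally have "(inf (inf a b) (inf b c), sup (sup a b) (sup b c)) \<in> R\<^sup>*" .
    then have "(inf a c, sup a c) \<in> R\<^sup>*"
      by (rule R_rtrancl_mono) (auto intro: le_infI1 le_infI2 le_supI1 le_supI2)
    then show ?thesis by simp
  qed
  have sup1: "(sup a c, sup b c) \<in> ?T" if "(a, b) \<in> ?T" for a b c
  proof -
    have "(sup (inf a b) c, sup (sup a b) c) \<in> R\<^sup>*" using that R_rtrancl_sup by blast
    then have "(inf (sup a c) (sup b c), sup (sup a c) (sup b c)) \<in> R\<^sup>*"
      by (rule R_rtrancl_mono) (auto intro: le_infI1 le_infI2 le_supI1 le_supI2)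
    then show ?thesis by simp
  qed
  have inf1: "(inf a c, inf b c) \<in> ?T" if "(a, b) \<in> ?T" for a b c
  proof -
    have "(inf (inf a b) c, inf (sup a b) c) \<in> R\<^sup>*" using that R_rtrancl_inf by blast
    then have "(inf (inf a c) (inf b c), sup (inf a c) (inf b c)) \<in> R\<^sup>*"
      by (rule R_rtrancl_mono) (auto intro: le_infI1 le_infI2 le_supI1 le_supI2)
    then show ?thesis by simp
  qed
  have "equiv UNIV ?T"
  proof (rule equivI)
    show "refl_on UNIV ?T" by (auto simp: refl_on_def)
    show "sym ?T" by (auto simp: sym_def inf.commute sup.commute)
    show "trans ?T" using tr by (blast intro: transI)
  qed simp
  moreover have "(sup a c, sup b d) \<in> ?T \<and> (inf a c, inf b d) \<in> ?T"
    if "(a, b) \<in> ?T" "(c, d) \<in> ?T" for a b c d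
    using tr[OF sup1[OF that(1), of c] sup1[OF that(2), of b, simplified sup.commute[of _ b]]]
      tr[OF inf1[OF that(1), of c] inf1[OF that(2), of b, simplified inf.commute[of _ b]]] by blast
  ultimately show ?thesis unfolding lattice_congruence_def by blast
qed

lemma con_in_R:
  assumes "p \<in> R" "prime_interval q" "q \<in> con p"
  shows "q \<in> R"
proof -
  obtain a b where p: "p = (a, b)" by (cases p)
  obtain c d where q: "q = (c, d)" by (cases q)
  have "p \<in> {(a, b). (inf a b, sup a b) \<in> R\<^sup>*}"
    using assms(1) R_le[of a b] unfolding p by (auto simp: inf.absorb1 sup.absorb2)
  then have "q \<in> {(a, b). (inf a b, sup a b) \<in> R\<^sup>*}"
    using con_least[OF lattice_congruence_R] assms(3) by blast
  moreover have "c \<lessdot> d" using assms(2) by (simp add: prime_interval_def q)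
  moreover have "c \<le> d" using calculation(2) coveredD less_imp_le by blast
  ultimately have "(c, d) \<in> R\<^sup>*" by (simp add: q inf.absorb1 sup.absorb2)
  then show ?thesis unfolding q using R_rtrancl_covered \<open>c \<lessdot> d\<close> by blast
qed

end

section \<open>Swings and switches\<close>

lemma lattice_iso_onto_le_iff:
  assumes "lattice_iso_onto f S"
  shows "f a \<le> f b \<longleftrightarrow> a \<le> b"
proof -
  have "inj f" "f (inf a b) = inf (f a) (f b)"
    using assms by (auto simp: lattice_iso_onto_def bij_betw_def)
  then show ?thesis by (metis inf.absorb_iff1 injD)
qed

lemma lattice_iso_onto_less_iff:
  assumes "lattice_iso_onto f S"
  shows "f a < f b \<longleftrightarrow> a < b"
  using lattice_iso_onto_le_iff[OF assms] by (simp add: less_le_not_le)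

lemma lattice_iso_onto_range: "lattice_iso_onto f S \<Longrightarrow> S = range f"
  by (simp add: lattice_iso_onto_def bij_betw_def)

lemma lattice_iso_onto_sublattice:
  assumes "lattice_iso_onto f S"
  shows "sublattice S"
  unfolding sublattice_def lattice_iso_onto_range[OF assms]
  using assms by (auto simp: lattice_iso_onto_def) (metis rangeI)+

lemma covered_in_iso:
  assumes "lattice_iso_onto f S"
  shows "covered_in S (f a) (f b) \<longleftrightarrow> a \<lessdot> b"
  unfolding covered_in_def lattice_iso_onto_range[OF assms]
  using lattice_iso_onto_less_iff[OF assms] by auto

text \<open>Translates the last condition in \<open>swings\<close> into the statement that
  \<open>fst q\<close> is the image of \<open>S7_a\<close>.\<close>

lemma s7_proper_dual_atoms:
  assumes f: "lattice_iso_onto (f :: s7 \<Rightarrow> 'a::lattice) S"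
  shows "{d. dual_atom_in S d \<and> proper_join_in S d} = {f S7_a}"
proof -
  have S: "S = range f" by (rule lattice_iso_onto_range[OF f])
  have sup: "sup (f a) (f b) = f (sup a b)" for a b
    using f by (simp add: lattice_iso_onto_def)
  have eq: "f a = f b \<longleftrightarrow> a = b" for a b
    using f by (auto simp: lattice_iso_onto_def bij_betw_def dest: injD)
  have da: "dual_atom_in S (f d) \<longleftrightarrow> d \<lessdot> S7_i" for d
  proof -
    have "(\<forall>z. z \<le> t) \<longleftrightarrow> t = S7_i" for t :: s7
      unfolding s7_all by (cases t) (auto simp: less_eq_s7_def)
    then show ?thesis
      unfolding dual_atom_in_def using covered_in_iso[OF f] lattice_iso_onto_le_iff[OF f]
      by (auto simp: S)
  qed
  have pj: "proper_join_in S (f d) \<longleftrightarrow> (\<exists>a b. d = sup a b \<and> d \<noteq> a \<and> d \<noteq> b)" for d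
    unfolding proper_join_in_def by (auto simp: S sup eq)
  have not_pj: "\<not> proper_join_in S (f S7_x)" "\<not> proper_join_in S (f S7_m)"
    unfolding pj not_ex s7_all by (simp_all add: sup_s7_def less_eq_s7_def)
  have "S7_a = sup S7_y S7_o" by (simp add: sup_s7_def less_eq_s7_def)
  then have pj_a: "proper_join_in S (f S7_a)" unfolding pj by blast
  have "dual_atom_in S (f d) \<and> proper_join_in S (f d) \<longleftrightarrow> d = S7_a" for d
    using not_pj pj_a by (cases d) (simp_all add: da s7_covered_by_iff)
  then have *: "dual_atom_in S (f d) \<and> proper_join_in S (f d) \<longleftrightarrow> f d = f S7_a" for d
    using eq by simp
  show ?thesis
  proof (rule set_eqI)
    fix v
    show "v \<in> {d. dual_atom_in S d \<and> proper_join_in S d} \<longleftrightarrow> v \<in> {f S7_a}"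
    proof (cases "v \<in> range f")
      case True
      then show ?thesis using * by auto
    next
      case False
      then show ?thesis by (auto simp: dual_atom_in_def covered_in_def S)
    qed
  qed
qed

text \<open>Here \<open>a\<close>, \<open>c\<close>, \<open>b\<close> play the roles of
  \<open>S7_x\<close>, \<open>S7_a\<close>, \<open>S7_m\<close>, while \<open>y\<close> and
  \<open>m\<close> play those of \<open>S7_y\<close> and \<open>S7_o\<close>. As distinct lower
  covers of \<open>c\<close>, \<open>y\<close> and \<open>m\<close> join to \<open>c\<close>;
  \<open>mid\<close> makes \<open>inf a b\<close> the meet of \<open>y\<close> and
  \<open>m\<close>.\<close>

lemma coatoms_generate_s7:
  fixes x :: "'a::lattice"
  assumes cov: "a \<lessdot> x" "c \<lessdot> x" "b \<lessdot> x" "a \<noteq> c" "b \<noteq> c" "a \<noteq> b"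
    and low: "inf a c \<lessdot> c" "inf b c \<lessdot> c" "inf a c \<noteq> inf b c"
    and mid: "inf a b \<le> c"
  shows "\<exists>f. lattice_iso_onto f (sublattice_generated {a, b, c}) \<and> f S7_a = c"
proof -
  define u y m where "u = inf a b" and "y = inf a c" and "m = inf b c"
  have le: "u \<le> y" "u \<le> m" "y \<le> a" "y \<le> c" "m \<le> c" "m \<le> b" "a \<le> x" "b \<le> x" "c \<le> x"
    using mid cov coveredD less_imp_le by (auto simp: u_def y_def m_def)
  have le': "u \<le> a" "u \<le> b" "u \<le> c" "u \<le> x" "y \<le> x" "m \<le> x" using le order.trans by blast+
  have nle: "\<not> a \<le> b" "\<not> b \<le> a" "\<not> a \<le> c" "\<not> c \<le> a" "\<not> b \<le> c" "\<not> c \<le> b"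
    using cov coatom_le_iff by metis+
  have ym: "\<not> y \<le> m" "\<not> m \<le> y"
    using low covered_between[OF low(1), of m] covered_between[OF low(2), of y] coveredD le(4,5)
    unfolding y_def m_def by (metis order_less_irrefl)+
  have mi: "inf a m = u" "inf y b = u" "inf y m = u"
    using mid by (auto simp: u_def y_def m_def inf.absorb1 inf.assoc inf.commute inf.left_commute)
      (metis inf.absorb1 inf.assoc inf.commute)+
  have nle2: "\<not> y \<le> b" "\<not> m \<le> a" using ym mi le by (metis inf.absorb1 inf.absorb2)+
  have si: "sup a b = x" "sup a c = x" "sup c b = x" using cov coatoms_sup by metis+
  have s: "sup y m = c"
    using covered_between[OF low(1), of "sup y m"] ym le unfolding y_def[symmetric]
    by (metis le_sup_iff order_refl sup.absorb_iff1)
  have "sup a m = x" using covered_between[OF cov(1), of "sup a m"] nle2 le le' by (metis le_sup_iff sup.cobounded1 sup.cobounded2)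
  moreover have "sup y b = x" using covered_between[OF cov(3), of "sup y b"] nle2 le le' by (metis le_sup_iff sup.cobounded1 sup.cobounded2)
  moreover note s si mi
  moreover have "inf a b = u" "inf a c = y" "inf c b = m" by (auto simp: u_def y_def m_def inf.commute)
  ultimately have si: "sup a b = x" "sup a c = x" "sup c b = x" "sup y m = c" "sup a m = x" "sup y b = x"
    "inf a b = u" "inf a c = y" "inf c b = m" "inf a m = u" "inf y b = u" "inf y m = u"
    by blast+
  \<comment> \<open>The commuted equations complete the tables of joins and meets that the
    simplifier needs below.\<close>
  note si = si si[unfolded sup.commute[of a] sup.commute[of c b] sup.commute[of y]
      inf.commute[of a] inf.commute[of c b] inf.commute[of y]]
  have ne: "u \<noteq> y" "u \<noteq> m" "u \<noteq> a" "u \<noteq> b" "u \<noteq> c" "u \<noteq> x" "y \<noteq> m" "y \<noteq> a" "y \<noteq> b" "y \<noteq> c" "y \<noteq> x"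
    "m \<noteq> a" "m \<noteq> b" "m \<noteq> c" "m \<noteq> x" "a \<noteq> b" "a \<noteq> c" "a \<noteq> x" "b \<noteq> c" "b \<noteq> x" "c \<noteq> x"
    using nle ym le le' nle2 by auto
  define f where "f z = (case z of S7_u \<Rightarrow> u | S7_y \<Rightarrow> y | S7_o \<Rightarrow> m | S7_x \<Rightarrow> a | S7_a \<Rightarrow> c
    | S7_m \<Rightarrow> b | S7_i \<Rightarrow> x)" for z
  have "inj f"
    unfolding inj_def s7_all by (simp add: f_def ne ne[symmetric])
  moreover have "f (sup p q) = sup (f p) (f q)" for p q
    by (cases p; cases q; simp add: f_def sup_s7_def less_eq_s7_def si le le' sup.absorb1 sup.absorb2)
  moreover have "f (inf p q) = inf (f p) (f q)" for p q
    by (cases p; cases q; simp add: f_def inf_s7_def less_eq_s7_def si le le' inf.absorb1 inf.absorb2)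
  ultimately have f: "lattice_iso_onto f (range f)"
    by (simp add: lattice_iso_onto_def bij_betw_def)
  have "range f = sublattice_generated {a, b, c}"
  proof
    have "{a, b, c} \<subseteq> range f"
      by (auto simp: f_def intro: range_eqI[of _ _ S7_x] range_eqI[of _ _ S7_m] range_eqI[of _ _ S7_a])
    then show "sublattice_generated {a, b, c} \<subseteq> range f"
      unfolding sublattice_generated_def using lattice_iso_onto_sublattice[OF f] by blast
    show "range f \<subseteq> sublattice_generated {a, b, c}"
      unfolding sublattice_generated_def
    proof (intro Inter_greatest subsetI)
      fix T z assume "T \<in> {S. sublattice S \<and> {a, b, c} \<subseteq> S}" "z \<in> range f"
      then have T: "a \<in> T" "b \<in> T" "c \<in> T" "\<And>v w. v \<in> T \<Longrightarrow> w \<in> T \<Longrightarrow> sup v w \<in> T \<and> inf v w \<in> T"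
        by (auto simp: sublattice_def)
      then have "x \<in> T" "y \<in> T" "m \<in> T" "u \<in> T" using si by metis+
      then show "z \<in> T" using \<open>z \<in> range f\<close> T by (auto simp: f_def split: s7.splits)
    qed
  qed
  with f show ?thesis by (intro exI[of _ f]) (simp add: f_def)
qed

lemma coatoms_swing:
  fixes x :: "'a::lattice"
  assumes "a \<lessdot> x" "c \<lessdot> x" "b \<lessdot> x" "a \<noteq> c" "b \<noteq> c" "a \<noteq> b"
    and "inf a c \<lessdot> c" "inf b c \<lessdot> c" "inf a c \<noteq> inf b c" "inf a b \<le> c"
  shows "swings (a, x) (c, x)"
proof -
  obtain f where f: "lattice_iso_onto f (sublattice_generated {a, b, c})" "f S7_a = c"
    using coatoms_generate_s7[OF assms] by blast
  let ?S = "sublattice_generated {a, c, b}"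
  have iso: "lattice_iso_onto f ?S" using f(1) by (simp add: insert_commute)
  then have "{d. dual_atom_in ?S d \<and> proper_join_in ?S d} = {c}"
    using s7_proper_dual_atoms f(2) by blast
  then show ?thesis
    unfolding swings_def fst_conv snd_conv using assms(3-6) iso
    by (intro conjI exI[of _ b] exI[of _ ?S] exI[of _ f]) simp_all
qed

lemma covering_m3I:
  fixes u i :: "'a::lattice"
  assumes "u \<lessdot> a" "u \<lessdot> b" "u \<lessdot> c" "a \<lessdot> i" "b \<lessdot> i" "c \<lessdot> i" "a \<noteq> b" "a \<noteq> c" "b \<noteq> c"
  shows "covering_m3 {u, a, b, c, i}"
proof -
  define f where "f z = (case z of M3_zero \<Rightarrow> u | M3_a \<Rightarrow> a | M3_b \<Rightarrow> b | M3_c \<Rightarrow> c | M3_one \<Rightarrow> i)" for z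
  have S: "{u, a, b, c, i} = range f"
  proof -
    have "range f = f ` {M3_zero, M3_a, M3_b, M3_c, M3_one}"
      by (rule arg_cong[of _ _ "image f"]) (use m3.exhaust in blast)
    then show ?thesis by (simp add: f_def)
  qed
  have lt: "u < a" "u < b" "u < c" "a < i" "b < i" "c < i" "u < i"
    using assms coveredD order.strict_trans by blast+
  have si: "sup a b = i" "sup a c = i" "sup b c = i" "sup b a = i" "sup c a = i" "sup c b = i"
    "inf a b = u" "inf a c = u" "inf b c = u" "inf b a = u" "inf c a = u" "inf c b = u"
    using assms coatoms_sup atoms_inf by metis+
  have "inj f"
    unfolding inj_def using lt assms(7-9) by (auto simp: f_def split: m3.splits)
  moreover have "f (sup p q) = sup (f p) (f q)" for p q
    using lt by (cases p; cases q; simp add: f_def sup_m3_def less_eq_m3_def si sup.absorb1 sup.absorb2 less_imp_le)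
  moreover have "f (inf p q) = inf (f p) (f q)" for p q
    using lt by (cases p; cases q; simp add: f_def inf_m3_def less_eq_m3_def si inf.absorb1 inf.absorb2 less_imp_le)
  ultimately have f: "lattice_iso_onto f {u, a, b, c, i}"
    by (simp add: lattice_iso_onto_def bij_betw_def S)
  have cov: "p \<lessdot> q" if "covered_in {u, a, b, c, i} p q" for p q
  proof -
    let ?A = "{a, b, c}"
    have "\<not> (p = u \<and> q = i)" using lt that by (auto simp: covered_in_def)
    moreover have "p = u \<or> p \<in> ?A \<or> p = i" "q = u \<or> q \<in> ?A \<or> q = i" "p < q"
      using that by (auto simp: covered_in_def)
    moreover have "\<forall>v\<in>?A. \<forall>w\<in>?A. \<not> v < w"
      using assms coatom_le_iff less_imp_le by (metis insertE empty_iff less_irrefl)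
    moreover have "\<forall>v\<in>?A. u \<lessdot> v \<and> v \<lessdot> i \<and> u < v \<and> v < i" using assms lt by auto
    ultimately show ?thesis using lt(7) by (meson less_asym less_irrefl)
  qed
  show ?thesis
    unfolding covering_m3_def
    by (intro conjI allI impI exI) (fact lattice_iso_onto_sublattice[OF f], fact f, fact cov)
qed

section \<open>Single steps of a sequence\<close>

definition ps_c_step :: "('a::lattice \<Rightarrow> complex) \<Rightarrow> 'a \<times> 'a \<Rightarrow> 'a \<times> 'a \<Rightarrow> bool" where
  "ps_c_step D p q \<longleftrightarrow> prime_interval q \<and> (cell_perspective D p q \<or> swings p q \<or> switches p q)"

lemma cell_perspective_sym: "cell_perspective D p q \<Longrightarrow> cell_perspective D q p"
  unfolding cell_perspective_def by (simp only: insert_commute[of q p])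

lemma switches_sym: "switches p q \<Longrightarrow> switches q p"
  unfolding switches_def by auto

text \<open>If the square is no 4-cell, an element drawn inside it lies strictly between
  \<open>u\<close> and \<open>i\<close> and completes it to a covering \<open>M3\<close>. Cell
  perspectivity and switching are symmetric, so both directions follow.\<close>

lemma covering_square_step:
  fixes D :: "'a::{finite,lattice} \<Rightarrow> complex"
  assumes pd: "planar_diagram D" and "upper_semimodular TYPE('a)"
    and sq: "u \<lessdot> v" "v \<lessdot> i" "u \<lessdot> w" "w \<lessdot> i" "v \<noteq> w"
  shows "ps_c_step D (u, v) (w, i)" "ps_c_step D (w, i) (u, v)"
proof -
  interpret semimodular "TYPE('a)" by unfold_locales fact
  have "cell_perspective D (u, v) (w, i) \<or> switches (u, v) (w, i)"
  proof (cases "four_cell D u v w i")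
    case True
    then show ?thesis unfolding cell_perspective_def by blast
  next
    case False
    then obtain z where "u < z" "z < i" "z \<noteq> v" "z \<noteq> w"
      using inside_square_between[OF pd sq(1-4)] sq unfolding four_cell_def by blast
    have "u \<lessdot> z"
    proof -
      \<comment> \<open>A cover \<open>a\<close> of \<open>u\<close> below \<open>z\<close> differs
        from one of \<open>v\<close>, \<open>w\<close>; joined with that one it gives
        \<open>i\<close>, so \<open>a\<close> is a lower cover of \<open>i\<close> and must be
        \<open>z\<close>.\<close>
      obtain a where a: "u \<lessdot> a" "a \<le> z" using \<open>u < z\<close> by (rule covered_above)
      obtain e where e: "e \<in> {v, w}" "a \<noteq> e" using sq(5) by blast
      then have *: "a \<lessdot> sup a e" "e \<lessdot> sup a e" "e \<lessdot> i"
        using atoms_sup_covered[of u a e] a sq by auto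
      have "sup a e \<le> i" using a \<open>z < i\<close> *(3) coveredD by (meson dual_order.trans le_supI less_imp_le)
      then have "sup a e = i" using *(2,3) covered_between coveredD by (metis less_imp_le less_irrefl)
      then have "a \<lessdot> i" using * by simp
      then have "a = z" using covered_between[of a i z] a \<open>z < i\<close> less_imp_le by blast
      then show ?thesis using a by simp
    qed
    moreover have "z \<lessdot> i"
    proof -
      have "v \<lessdot> sup v z" "z \<lessdot> sup v z" using atoms_sup_covered[OF sq(1) \<open>u \<lessdot> z\<close>] \<open>z \<noteq> v\<close> by auto
      moreover have "sup v z \<le> i" using sq(2) \<open>z < i\<close> coveredD less_imp_le by (metis le_supI)
      ultimately have "sup v z = i" using sq(2) covered_between coveredD by (metis less_imp_le less_irrefl)
      then show ?thesis using \<open>z \<lessdot> sup v z\<close> by simp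
    qed
    ultimately have "covering_m3 {u, v, w, z, i}"
      using covering_m3I sq \<open>z \<noteq> v\<close> \<open>z \<noteq> w\<close> by metis
    moreover have "u \<noteq> w" using sq(3) coveredD by blast
    ultimately have "switches (u, v) (w, i)"
      unfolding switches_def by (intro conjI exI[of _ "{u, v, w, z, i}"]) auto
    then show ?thesis ..
  qed
  then show "ps_c_step D (u, v) (w, i)" "ps_c_step D (w, i) (u, v)"
    unfolding ps_c_step_def using sq cell_perspective_sym[of D "(u, v)" "(w, i)"] switches_sym[of "(u, v)" "(w, i)"]
    by (auto simp: prime_interval_def)
qed

text \<open>The two lower covers \<open>inf a c\<close> and \<open>inf b c\<close> of
  \<open>c\<close> decide: if equal, they complete a covering \<open>M3\<close>; if distinct, the
  three lower covers of \<open>x\<close> generate an \<open>S7\<close>.\<close>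

lemma coatoms_step:
  fixes x :: "'a::{finite,lattice}"
  assumes "upper_semimodular TYPE('a)"
    and cov: "a \<lessdot> x" "c \<lessdot> x" "b \<lessdot> x" "a \<noteq> c" "b \<noteq> c" "a \<noteq> b"
    and low: "inf a c \<lessdot> c" "inf b c \<lessdot> c" and mid: "inf a b \<le> c"
  shows "ps_c_step D (a, x) (c, x)"
proof -
  interpret semimodular "TYPE('a)" by unfold_locales fact
  have "swings (a, x) (c, x) \<or> switches (a, x) (c, x)"
  proof (cases "inf a c = inf b c")
    case True
    have "inf a c \<lessdot> a" using coatoms_inf_covered_commute cov low by blast
    moreover have "inf a c \<lessdot> b" using coatoms_inf_covered_commute[of b x c] cov low True by simp
    ultimately have "covering_m3 {inf a c, a, c, b, x}" using cov low by (intro covering_m3I) auto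
    then have "switches (a, x) (c, x)"
      unfolding switches_def using cov by (intro conjI exI[of _ "{inf a c, a, c, b, x}"]) auto
    then show ?thesis ..
  next
    case False
    then show ?thesis using coatoms_swing cov low mid by blast
  qed
  then show ?thesis using cov by (auto simp: ps_c_step_def prime_interval_def)
qed

section \<open>Steps preserve congruence spreading\<close>

lemma congruence_sup: "lattice_congruence \<theta> \<Longrightarrow> (a, b) \<in> \<theta> \<Longrightarrow> (sup a c, sup b c) \<in> \<theta>"
  unfolding lattice_congruence_def equiv_def refl_on_def by blast

lemma congruence_inf: "lattice_congruence \<theta> \<Longrightarrow> (a, b) \<in> \<theta> \<Longrightarrow> (inf a c, inf b c) \<in> \<theta>"
  unfolding lattice_congruence_def equiv_def refl_on_def by blast

lemma congruence_sym: "lattice_congruence \<theta> \<Longrightarrow> (a, b) \<in> \<theta> \<Longrightarrow> (b, a) \<in> \<theta>"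
  unfolding lattice_congruence_def equiv_def by (blast dest: symD)

lemma congruence_trans: "lattice_congruence \<theta> \<Longrightarrow> (a, b) \<in> \<theta> \<Longrightarrow> (b, c) \<in> \<theta> \<Longrightarrow> (a, c) \<in> \<theta>"
  unfolding lattice_congruence_def equiv_def by (blast dest: transD)

lemma congruence_square:
  assumes \<theta>: "lattice_congruence \<theta>"
    and sq: "u \<lessdot> v" "v \<lessdot> i" "u \<lessdot> w" "w \<lessdot> i" "v \<noteq> w"
  shows "(u, v) \<in> \<theta> \<longleftrightarrow> (w, i) \<in> \<theta>"
proof
  have *: "sup v w = i" "inf v w = u" "sup u w = w" "inf i v = v"
    using sq coatoms_sup atoms_inf coveredD by (metis sup.absorb2 inf.absorb2 less_imp_le)+
  show "(w, i) \<in> \<theta>" if "(u, v) \<in> \<theta>" using congruence_sup[OF \<theta> that, of w] * by simp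
  show "(u, v) \<in> \<theta>" if "(w, i) \<in> \<theta>" using congruence_inf[OF \<theta> that, of v] * by (simp add: inf.commute)
qed

lemma congruence_cell_perspective:
  assumes \<theta>: "lattice_congruence \<theta>" and "cell_perspective D p q" "p \<in> \<theta>"
  shows "q \<in> \<theta>"
proof -
  obtain u v w i where c: "four_cell D u v w i"
      "{p, q} = {(u, v), (w, i)} \<or> {p, q} = {(u, w), (v, i)}"
    using assms(2) unfolding cell_perspective_def by blast
  then have "(u, v) \<in> \<theta> \<longleftrightarrow> (w, i) \<in> \<theta>" "(u, w) \<in> \<theta> \<longleftrightarrow> (v, i) \<in> \<theta>"
    using congruence_square[OF \<theta>] unfolding four_cell_def by metis+
  then show ?thesis using c(2) assms(3) by (auto simp: doubleton_eq_iff)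
qed

text \<open>Inside the \<open>S7\<close>, meet the collapsed pair with the other dual atom that is
  not a proper join, then join with \<open>S7_a\<close>: this yields the pair of \<open>S7_a\<close>
  and \<open>S7_i\<close>.\<close>

lemma congruence_swings:
  assumes \<theta>: "lattice_congruence \<theta>" and sw: "swings p q"
    and pr: "prime_interval p" "prime_interval q" and p: "p \<in> \<theta>"
  shows "q \<in> \<theta>"
proof -
  obtain c S f where c: "c \<lessdot> snd p" "c \<noteq> fst p" "c \<noteq> fst q"
    and S: "S = sublattice_generated {fst p, fst q, c}"
    and f: "lattice_iso_onto (f :: s7 \<Rightarrow> _) S"
    and d: "{d. dual_atom_in S d \<and> proper_join_in S d} = {fst q}"
    and pq: "p \<noteq> q" "snd p = snd q"
    using sw unfolding swings_def by blast
  have fq: "fst q = f S7_a" using s7_proper_dual_atoms[OF f] d by simp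
  have cov: "fst p \<lessdot> snd p" "fst q \<lessdot> snd p"
    using pr pq(2) by (auto simp: prime_interval_def)
  \<comment> \<open>The aim is \<open>f S7_i = snd p\<close>. The generators lie in this sublattice,
    so the whole image of \<open>f\<close> lies below \<open>snd p\<close>.\<close>
  have "sublattice {..snd p}"
    unfolding sublattice_def by (auto intro: le_infI1)
  moreover have "{fst p, fst q, c} \<subseteq> {..snd p}" using cov c(1) coveredD less_imp_le by auto
  ultimately have "S \<subseteq> {..snd p}" unfolding S sublattice_generated_def by blast
  then have top: "f z \<le> snd p" for z using lattice_iso_onto_range[OF f] by auto
  have "{fst p, fst q, c} \<subseteq> S" unfolding S sublattice_generated_def by blast
  then obtain z z' where z: "fst p = f z" "c = f z'" using lattice_iso_onto_range[OF f] by auto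
  have "w \<le> S7_i" for w by (cases w) (auto simp: less_eq_s7_def)
  then have "f z \<le> f S7_i" "f z' \<le> f S7_i" using lattice_iso_onto_le_iff[OF f] by blast+
  then have "f S7_i = fst p \<or> f S7_i = snd p"
    using covered_between[OF cov(1), of "f S7_i"] top[of S7_i] z(1) by simp
  moreover have "f S7_i \<noteq> fst p"
    using coatom_le_iff[OF c(1) cov(1)] c(2) \<open>f z' \<le> f S7_i\<close> z(2) by metis
  ultimately have "f S7_i = snd p" by blast
  then have "f z \<lessdot> f S7_i" using cov z by simp
  then have "z \<lessdot> S7_i"
    using lattice_iso_onto_less_iff[OF f] unfolding covered_in_def by blast
  moreover have "z \<noteq> S7_a" using pq z fq by (metis prod_eqI)
  ultimately have z': "z = S7_x \<or> z = S7_m" by (auto simp: s7_covered_by_iff)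
  define e where "e = (if z = S7_x then S7_m else S7_x)"
  have e: "sup (inf z e) S7_a = S7_a" "inf S7_i e = e" "sup e S7_a = S7_i"
    using z' by (auto simp: e_def sup_s7_def inf_s7_def less_eq_s7_def)
  have hom: "f (sup a b) = sup (f a) (f b)" "f (inf a b) = inf (f a) (f b)" for a b
    using f by (simp_all add: lattice_iso_onto_def)
  have *: "sup (inf (f z) (f e)) (f S7_a) = f S7_a" "inf (f S7_i) (f e) = f e" "sup (f e) (f S7_a) = f S7_i"
    by (simp_all only: hom[symmetric] e)
  have "(f z, f S7_i) \<in> \<theta>" using p \<open>f S7_i = snd p\<close> unfolding z(1)[symmetric] by simp
  from congruence_sup[OF \<theta> congruence_inf[OF \<theta> this, of "f e"], of "f S7_a"]
  have "(f S7_a, f S7_i) \<in> \<theta>" using * by simp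
  then show ?thesis using fq \<open>f S7_i = snd p\<close> pq(2) by (metis prod.collapse)
qed

text \<open>\<open>M3\<close> is simple: any collapsed pair \<open>a < b\<close> leads to bottom and
  top being collapsed, and then everything is.\<close>

lemma m3_congruence:
  assumes \<theta>: "lattice_congruence \<theta>" and f: "lattice_iso_onto (f :: m3 \<Rightarrow> _) S"
    and "a < b" "(f a, f b) \<in> \<theta>"
  shows "(f c, f d) \<in> \<theta>"
proof -
  define T where "T a b \<longleftrightarrow> (f a, f b) \<in> \<theta>" for a b
  have T_sup: "T (sup a c) (sup b c)" and T_inf: "T (inf a c) (inf b c)" if "T a b" for a b c
    using that congruence_sup[OF \<theta>, of "f a" "f b" "f c"] congruence_inf[OF \<theta>, of "f a" "f b" "f c"] f
    by (auto simp: T_def lattice_iso_onto_def)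
  have T_trans: "T a c" if "T a b" "T b c" for a b c
    using that congruence_trans[OF \<theta>] by (auto simp: T_def)
  have T_sym: "T b a" if "T a b" for a b
    using that congruence_sym[OF \<theta>] by (auto simp: T_def)
  have "T a b" using assms by (simp add: T_def)
  have one: "T M3_zero M3_one" if "T a M3_one" "a \<in> {M3_a, M3_b, M3_c}" for a
  proof -
    \<comment> \<open>The other two atoms. Meeting the pair with them collapses each to the bottom;
      joining the first of these pairs with \<open>g\<close> links \<open>g\<close> to the
      top.\<close>
    define e g where "e = (if a = M3_a then M3_b else M3_a)" and "g = (if a = M3_c then M3_b else M3_c)"
    then have eg: "e \<noteq> g" "e \<noteq> a" "g \<noteq> a" "{e, g} \<subseteq> {M3_a, M3_b, M3_c}"
      using that(2) by auto
    have e: "T M3_zero e" using T_inf[OF that(1), of e] eg that(2)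
      by (auto simp: inf_m3_def less_eq_m3_def)
    have g: "T M3_zero g" using T_inf[OF that(1), of g] eg that(2)
      by (auto simp: inf_m3_def less_eq_m3_def)
    have "T g M3_one" using T_sup[OF e, of g] eg by (auto simp: sup_m3_def less_eq_m3_def)
    with g show ?thesis by (rule T_trans)
  qed
  have "T M3_zero M3_one"
  proof -
    consider "a = M3_zero" "b = M3_one" | "a \<in> {M3_a, M3_b, M3_c}" "b = M3_one"
      | "a = M3_zero" "b \<in> {M3_a, M3_b, M3_c}"
      using \<open>a < b\<close> by (cases a; cases b) (auto simp: less_m3_def less_eq_m3_def)
    then show ?thesis
    proof cases
      case 3
      obtain e where e: "e \<noteq> b" "e \<in> {M3_a, M3_b, M3_c}" by (cases b) auto
      have "T e M3_one" using T_sup[OF \<open>T a b\<close>, of e] 3 e by (auto simp: sup_m3_def less_eq_m3_def)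
      then show ?thesis using one e by blast
    qed (use \<open>T a b\<close> one in auto)
  qed
  have "T M3_zero c" for c
  proof -
    have "inf M3_zero c = M3_zero" "inf M3_one c = c"
      by (cases c; simp add: inf_m3_def less_eq_m3_def)+
    then show ?thesis using T_inf[OF \<open>T M3_zero M3_one\<close>, of c] by simp
  qed
  then have "T c d" using T_trans[OF T_sym] by blast
  then show ?thesis by (simp only: T_def)
qed

lemma congruence_switches:
  assumes \<theta>: "lattice_congruence \<theta>" and "switches p q" "prime_interval p" "p \<in> \<theta>"
  shows "q \<in> \<theta>"
proof -
  obtain S f where S: "{fst p, snd p, fst q, snd q} \<subseteq> S" and f: "lattice_iso_onto (f :: m3 \<Rightarrow> _) S"
    using assms(2) unfolding switches_def covering_m3_def by blast
  then obtain a b c d where abcd: "fst p = f a" "snd p = f b" "fst q = f c" "snd q = f d"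
    unfolding lattice_iso_onto_range[OF f] by auto
  have "f a < f b" using assms(3) coveredD abcd(1,2) by (metis prime_interval_def)
  then have "a < b" using lattice_iso_onto_less_iff[OF f] by blast
  moreover have "(f a, f b) \<in> \<theta>" using assms(4) by (simp flip: abcd)
  ultimately have "(f c, f d) \<in> \<theta>" by (rule m3_congruence[OF \<theta> f])
  then show ?thesis by (simp flip: abcd)
qed

lemma step_spreads:
  assumes "prime_interval p" "ps_c_step D p q"
  shows "con q \<subseteq> con p"
proof (rule con_least[OF lattice_congruence_con])
  show "q \<in> con p"
    using assms congruence_cell_perspective[OF lattice_congruence_con _ con_collapses]
      congruence_swings[OF lattice_congruence_con _ _ _ con_collapses]
      congruence_switches[OF lattice_congruence_con _ _ con_collapses]
    unfolding ps_c_step_def by blast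
qed

lemma ps_c_sequence_iff_steps:
  assumes "prime_interval p"
  shows "(\<exists>n r. ps_c_sequence D p q n r) \<longleftrightarrow> (ps_c_step D)\<^sup>*\<^sup>* p q"
proof
  assume "\<exists>n r. ps_c_sequence D p q n r"
  then obtain n r where "ps_c_sequence D p q n r" by blast
  then have r: "r 0 = p" "r n = q" "\<forall>i\<le>n. prime_interval (r i)"
    "\<forall>i\<in>{1..n}. cell_perspective D (r (i - 1)) (r i) \<or> swings (r (i - 1)) (r i) \<or>
       switches (r (i - 1)) (r i)"
    by (auto simp only: ps_c_sequence_def)
  have "i \<le> n \<Longrightarrow> (ps_c_step D)\<^sup>*\<^sup>* p (r i)" for i
  proof (induction i)
    case (Suc i)
    then have "ps_c_step D (r i) (r (Suc i))" using r(3) r(4)[rule_format, of "Suc i"] by (simp add: ps_c_step_def)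
    then show ?case using Suc by simp
  qed (simp add: r(1))
  then show "(ps_c_step D)\<^sup>*\<^sup>* p q" using r(2) by blast
next
  assume "(ps_c_step D)\<^sup>*\<^sup>* p q"
  then show "\<exists>n r. ps_c_sequence D p q n r"
  proof (induction rule: rtranclp_induct)
    case base
    then show ?case using assms
      by (intro exI[of _ 0] exI[of _ "\<lambda>_. p"]) (simp add: ps_c_sequence_def)
  next
    case (step q q')
    then obtain n r where "ps_c_sequence D p q n r" by blast
    then have "ps_c_sequence D p q' (Suc n) (r(Suc n := q'))"
      using step.hyps(2) unfolding ps_c_sequence_def ps_c_step_def
      by (auto simp: le_Suc_eq)
    then show ?case by blast
  qed
qed

theorem lemma11:
  fixes D :: "'a::{finite,lattice} \<Rightarrow> complex"
    and p q :: "'a \<times> 'a"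
  assumes "planar_diagram D"
    and "upper_semimodular TYPE('a)"
    and "prime_interval p" and "prime_interval q" and "p \<noteq> q"
  shows "congruence_spreads p q \<longleftrightarrow> (\<exists>n r. ps_c_sequence D p q n r)"
proof -
  let ?R = "{r. (ps_c_step D)\<^sup>*\<^sup>* p r}"
  have prime: "prime_interval r" if "(ps_c_step D)\<^sup>*\<^sup>* p r" for r
    using that assms(3) by (cases rule: rtranclp.cases) (auto simp: ps_c_step_def)
  have closed: "r' \<in> ?R" if "r \<in> ?R" "ps_c_step D r r'" for r r'
    using that by auto
  interpret swing_closed "TYPE('a)" "slope D" ?R
  proof
    show "upper_semimodular TYPE('a)" by fact
    show "c = d" if "c \<lessdot> x" "d \<lessdot> x" "slope D x c = slope D x d" for c d x
      using slope_inj[OF assms(1) that] .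
    show "inf a b \<le> c" if "a \<lessdot> x" "c \<lessdot> x" "b \<lessdot> x" "slope D x a < slope D x c" "slope D x c < slope D x b"
      for a b c x
      using inf_le_middle_coatom[OF assms(1) that] .
    show "a \<lessdot> b" if "(a, b) \<in> ?R" for a b
      using prime that by (auto simp: prime_interval_def)
    show "(u, v) \<in> ?R \<longleftrightarrow> (w, i) \<in> ?R" if "u \<lessdot> v" "v \<lessdot> i" "u \<lessdot> w" "w \<lessdot> i" "v \<noteq> w" for u v w i
      using covering_square_step[OF assms(1,2) that] closed by blast
    show "(c, x) \<in> ?R" if "a \<lessdot> x" "c \<lessdot> x" "b \<lessdot> x" "a \<noteq> c" "b \<noteq> c" "a \<noteq> b"
      "inf a c \<lessdot> c" "inf b c \<lessdot> c" "inf a b \<le> c" "(a, x) \<in> ?R" for a b c x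
      using coatoms_step[OF assms(2) that(1-9)] closed that(10) by blast
  qed
  have "(ps_c_step D)\<^sup>*\<^sup>* p q \<Longrightarrow> con q \<subseteq> con p"
  proof (induction rule: rtranclp_induct)
    case (step r r')
    then show ?case using step_spreads[of r D r'] prime by blast
  qed simp
  \<comment> \<open>Since \<open>q\<close> is in \<open>con q\<close>, it is collapsed by
    \<open>con p\<close>; as \<open>p\<close> itself is in \<open>?R\<close>,
    \<open>con_in_R\<close> puts \<open>q\<close> into \<open>?R\<close>.\<close>
  moreover have "(ps_c_step D)\<^sup>*\<^sup>* p q" if "con q \<subseteq> con p"
    using con_in_R[of p q] assms(4) that con_collapses by blast
  ultimately show ?thesis
    unfolding ps_c_sequence_iff_steps[OF assms(3)] congruence_spreads_def by blast
qed

end
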